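(* Let $G$ be a non-Hausdorff étale groupoid and $\tilde{G}$ its Hausdorff cover. Assume that $G$ can be covered by countably many open bisections. Suppose that $G$ has the property that $\#\,\mathbf{g}<\infty$ for all $\mathbf{g}\in\tilde{G}$, and that for every decomposable function $\tilde{f}\colon\tilde{G}\to\mathbb{C}$, $\tilde{f}(\mathbf{g})=0$ for all $\mathbf{g}\in\tilde{G}_{\mathrm{ess}}$ implies that $\tilde{f}(\mathbf{g})=0$ for all $\mathbf{g}\in\tilde{G}$. Then $J=\{0\}$.
   Context: Groupoids. A groupoid $G$ is a small category all of whose morphisms are invertible, identified with its set of morphisms; $G^{(0)}\subseteq G$ is its set of units, $r,s\colon G\to G^{(0)}$ are range and source, and $G_x=s^{-1}(x)$. Topological groupoids (continuous range, source, multiplication, inversion) are always assumed locally compact with $G^{(0)}$ Hausdorff in the subspace topology; $G$ itself need not be Hausdorff, and compact subsets need not be closed. $G$ is étale if $r$ is a local homeomorphism. An open bisection is an open subset $U\subseteq G$ on which $r$ and $s$ are injective ($U$ is then locally compact Hausdorff). Write $X=G^{(0)}$. $C^*$-algebra and singular ideal. For an open bisection $U$, $C_c(U)$ is the set of continuous functions $U\to\mathbb{C}$ with compact support in $U$, extended by zero to $G$; $\mathcal{C}_c(G)$ is the linear span of all $C_c(U)$, a $*$-algebra under $f^*(g)=\overline{f(g^{-1})}$ and convolution. For $x\in X$, $\pi_x\colon\mathcal{C}_c(G)\to\mathcal{L}(\ell^2(G_x))$ is $\pi_x(f)\xi=f*\xi$; $C^*_r(G)$ is the completion of $\mathcal{C}_c(G)$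 in the norm $\sup_{x}\|\pi_x(f)\|$. Elements $f\in C^*_r(G)$ are viewed as functions on $G$ via $f(g)=\langle\pi_{s(g)}(f)\delta_{s(g)},\delta_g\rangle$. With $\mathrm{supp}^\circ(f)=\{f\neq0\}$, set $J=\{f\in C^*_r(G):s(\mathrm{supp}^\circ(f))\text{ has empty interior}\}$. Hausdorff cover. Equip the set of closed subsets of $G$ with the Fell topology, with basis the sets $\{F: F\cap U_i\neq\emptyset\ (1\le i\le n),\ F\cap K=\emptyset\}$ for $U_1,\dots,U_n\subseteq G$ open and $K\subseteq G$ compact. $\tilde{G}$ is the closure of $\{\{g\}:g\in G\}$ in the space of non-empty closed subsets, and $\iota\colon G\to\tilde{G}$, $\iota(g)=\{g\}$. $\tilde{G}$ is a locally compact Hausdorff étale groupoid with unit space $\tilde{X}$ the closure of $\iota(X)$, source $\tilde{s}(\mathbf{g})=\{g_1^{-1}g_2:g_1,g_2\in\mathbf{g}\}$, range $\tilde{r}(\mathbf{g})=\{g_1g_2^{-1}:g_1,g_2\in\mathbf{g}\}$, and product (when $\tilde{s}(\mathbf{g})=\tilde{r}(\mathbf{h})$) and inverse those of subsets of $G$. Here $\#\,\mathbf{g}$ is the cardinality of $\mathbf{g}$ as a subset of $G$. A function $\tilde{f}\colon\tilde{G}\to\mathbb{C}$ is decomposable if for all $\mathbf{g}\in\tilde{G}$ only finitely many $\tilde{f}(\iota(g))$, $g\in\mathbf{g}$, are non-zero and $\tilde{f}(\mathbf{g})=\sum_{g\in\mathbf{g}}\tilde{f}(\iota(g))$. Essential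 part. Let $\overline{X}$ be the closure of $X$ in $G$, $D=s(\overline{X}\setminus X)$ and $C=X\setminus D$. Let $\tilde{X}_{\mathrm{ess}}$ be the closure of $\iota(C)$ in $\tilde{X}$ and $\tilde{G}_{\mathrm{ess}}=\{\mathbf{g}\in\tilde{G}:\tilde{r}(\mathbf{g}),\tilde{s}(\mathbf{g})\in\tilde{X}_{\mathrm{ess}}\}$. *)

theory Defs
  imports "HOL-Analysis.Analysis"
begin

section \<open>Topological groupoids\<close>

text \<open>The groupoid is identified with its set of morphisms, which is a whole type; its units are
  morphisms.  The multiplication is a total HOL function, and nothing is assumed about
  \<open>gmult G g h\<close> unless \<open>src G g = rng G h\<close>.\<close>

record 'g groupoid_ops =
  gmult :: "'g \<Rightarrow> 'g \<Rightarrow> 'g"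
  ginv :: "'g \<Rightarrow> 'g"
  src :: "'g \<Rightarrow> 'g"
  rng :: "'g \<Rightarrow> 'g"

definition units :: "'g groupoid_ops \<Rightarrow> 'g set" where
  "units G = range (src G)"

definition composable :: "'g groupoid_ops \<Rightarrow> ('g \<times> 'g) set" where
  "composable G = {(g, h). src G g = rng G h}"

locale groupoid =
  fixes G :: "'g groupoid_ops"
  assumes src_src: "src G (src G g) = src G g"
    and rng_src: "rng G (src G g) = src G g"
    and src_rng: "src G (rng G g) = rng G g"
    and rng_rng: "rng G (rng G g) = rng G g"
    and src_mult: "src G g = rng G h \<Longrightarrow> src G (gmult G g h) = src G h"
    and rng_mult: "src G g = rng G h \<Longrightarrow> rng G (gmult G g h) = rng G g"
    and mult_assoc: "src G g = rng G h \<Longrightarrow> src G h = rng G k \<Longrightarrow>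
      gmult G (gmult G g h) k = gmult G g (gmult G h k)"
    and mult_src: "gmult G g (src G g) = g"
    and rng_mult_left: "gmult G (rng G g) g = g"
    and src_inv: "src G (ginv G g) = rng G g"
    and rng_inv: "rng G (ginv G g) = src G g"
    and inv_mult: "gmult G (ginv G g) g = src G g"
    and mult_inv: "gmult G g (ginv G g) = rng G g"

locale topological_groupoid = groupoid G
  for G :: "'g::topological_space groupoid_ops" +
  assumes continuous_src: "continuous_on UNIV (src G)"
    and continuous_rng: "continuous_on UNIV (rng G)"
    and continuous_inv: "continuous_on UNIV (ginv G)"
    and continuous_mult: "continuous_on (composable G) (\<lambda>(g, h). gmult G g h)"
    and locally_compact: "locally_compact_space (euclidean :: 'g topology)"
    and Hausdorff_units: "Hausdorff_space (top_of_set (units G))"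

text \<open>Etale: the range map, as a map onto the space of units, is a local homeomorphism.\<close>

locale etale_groupoid = topological_groupoid G
  for G :: "'g::topological_space groupoid_ops" +
  assumes etale: "\<exists>U h. open U \<and> g \<in> U \<and> openin (top_of_set (units G)) (rng G ` U) \<and>
      homeomorphism U (rng G ` U) (rng G) h"

definition open_bisection :: "'g::topological_space groupoid_ops \<Rightarrow> 'g set \<Rightarrow> bool" where
  "open_bisection G U \<longleftrightarrow> open U \<and> inj_on (rng G) U \<and> inj_on (src G) U"


section \<open>The reduced groupoid algebra and the singular ideal\<close>

text \<open>\<open>C\<^sub>c(U)\<close>, with functions extended by zero; support and continuity refer to the
  subspace \<open>U\<close>, as these functions need not be continuous on all of the groupoid.\<close>

definition Cc_on :: "'g::topological_space set \<Rightarrow> ('g \<Rightarrow> complex) set" where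
  "Cc_on U = {f. continuous_on U f \<and> (\<forall>g. g \<notin> U \<longrightarrow> f g = 0) \<and>
     compact (top_of_set U closure_of {g \<in> U. f g \<noteq> 0})}"

text \<open>The complex linear span of all \<open>C\<^sub>c(U)\<close>.\<close>

definition Cc :: "'g::topological_space groupoid_ops \<Rightarrow> ('g \<Rightarrow> complex) set" where
  "Cc G = {(\<lambda>g. \<Sum>f\<in>F. a f * f g) | F a.
     finite F \<and> F \<subseteq> (\<Union>U\<in>{U. open_bisection G U}. Cc_on U)}"

text \<open>\<open>\<ell>\<^sup>2(S)\<close> for a subset \<open>S\<close> of the groupoid; its elements are extended by zero.\<close>

definition ell2 :: "'g set \<Rightarrow> ('g \<Rightarrow> complex) set" where
  "ell2 S = {\<xi>. (\<forall>g. g \<notin> S \<longrightarrow> \<xi> g = 0) \<and> (\<lambda>g. (cmod (\<xi> g))\<^sup>2) summable_on UNIV}"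

definition ell2_norm :: "('g \<Rightarrow> complex) \<Rightarrow> real" where
  "ell2_norm \<xi> = sqrt (\<Sum>\<^sub>\<infinity>g. (cmod (\<xi> g))\<^sup>2)"

definition ell2_inner :: "('g \<Rightarrow> complex) \<Rightarrow> ('g \<Rightarrow> complex) \<Rightarrow> complex" where
  "ell2_inner \<xi> \<eta> = (\<Sum>\<^sub>\<infinity>g. \<xi> g * cnj (\<eta> g))"

definition delta :: "'g \<Rightarrow> 'g \<Rightarrow> complex" where
  "delta h = (\<lambda>g. if g = h then 1 else 0)"

text \<open>Bounded linear operators on \<open>\<ell>\<^sup>2(S)\<close>, as extensional functions, so that equality
  of operators is equality in HOL.\<close>

definition bounded_ops :: "'g set \<Rightarrow> (('g \<Rightarrow> complex) \<Rightarrow> ('g \<Rightarrow> complex)) set" where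
  "bounded_ops S = {T \<in> ell2 S \<rightarrow>\<^sub>E ell2 S.
     (\<forall>a. \<forall>\<xi>\<in>ell2 S. \<forall>\<eta>\<in>ell2 S. T (\<lambda>g. a * \<xi> g + \<eta> g) = (\<lambda>g. a * T \<xi> g + T \<eta> g)) \<and>
     (\<exists>K. \<forall>\<xi>\<in>ell2 S. ell2_norm (T \<xi>) \<le> K * ell2_norm \<xi>)}"

definition convolution ::
    "'g groupoid_ops \<Rightarrow> ('g \<Rightarrow> complex) \<Rightarrow> ('g \<Rightarrow> complex) \<Rightarrow> 'g \<Rightarrow> complex" where
  "convolution G f \<xi> g =
     (\<Sum>\<^sub>\<infinity>(h, k)\<in>{(h, k) \<in> composable G. gmult G h k = g}. f h * \<xi> k)"

definition src_fibre :: "'g groupoid_ops \<Rightarrow> 'g \<Rightarrow> 'g set" where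
  "src_fibre G x = {g. src G g = x}"

type_synonym 'g op_family = "'g \<Rightarrow> ('g \<Rightarrow> complex) \<Rightarrow> ('g \<Rightarrow> complex)"

definition regular_rep :: "'g groupoid_ops \<Rightarrow> ('g \<Rightarrow> complex) \<Rightarrow> 'g op_family" where
  "regular_rep G f = (\<lambda>x\<in>units G. \<lambda>\<xi>\<in>ell2 (src_fibre G x). convolution G f \<xi>)"

text \<open>The norm \<open>sup\<^sub>x \<parallel>T\<^sub>x - S\<^sub>x\<parallel>\<close> (operator norms on \<open>\<ell>\<^sup>2(G\<^sub>x)\<close>), possibly infinite.\<close>

definition op_family_dist :: "'g groupoid_ops \<Rightarrow> 'g op_family \<Rightarrow> 'g op_family \<Rightarrow> ennreal" where
  "op_family_dist G T S =
     (SUP x\<in>units G. SUP \<xi>\<in>{\<xi> \<in> ell2 (src_fibre G x). ell2_norm \<xi> \<le> 1}.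
        ennreal (ell2_norm (\<lambda>g. T x \<xi> g - S x \<xi> g)))"

text \<open>The completion of \<open>Cc G\<close> in the reduced norm \<open>sup\<^sub>x \<parallel>\<pi>\<^sub>x(f)\<parallel>\<close>, realised as the closure of
  the isometric image \<open>{(\<pi>\<^sub>x(f))\<^sub>x}\<close> of \<open>Cc G\<close> among families of bounded operators
  \<open>T\<^sub>x\<close> on \<open>\<ell>\<^sup>2(G\<^sub>x)\<close>, which are complete for the sup norm.  The extension of \<open>\<pi>\<^sub>x\<close> to the
  completion is then \<open>T \<mapsto> T\<^sub>x\<close>.\<close>

definition reduced_algebra :: "'g::topological_space groupoid_ops \<Rightarrow> 'g op_family set" where
  "reduced_algebra G = {T \<in> (\<Pi>\<^sub>E x\<in>units G. bounded_ops (src_fibre G x)).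
     \<forall>\<epsilon>>0. \<exists>f\<in>Cc G. op_family_dist G T (regular_rep G f) < \<epsilon>}"

definition reduced_zero :: "'g groupoid_ops \<Rightarrow> 'g op_family" where
  "reduced_zero G = (\<lambda>x\<in>units G. \<lambda>\<xi>\<in>ell2 (src_fibre G x). (\<lambda>g. 0))"

text \<open>The function on the groupoid associated with an element of the reduced algebra.\<close>

definition as_function :: "'g groupoid_ops \<Rightarrow> 'g op_family \<Rightarrow> 'g \<Rightarrow> complex" where
  "as_function G T g = ell2_inner (T (src G g) (delta (src G g))) (delta g)"

definition open_support :: "('g \<Rightarrow> complex) \<Rightarrow> 'g set" where
  "open_support f = {g. f g \<noteq> 0}"

definition singular_ideal :: "'g::topological_space groupoid_ops \<Rightarrow> 'g op_family set" where
  "singular_ideal G = {T \<in> reduced_algebra G.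
     top_of_set (units G) interior_of (src G ` open_support (as_function G T)) = {}}"


section \<open>The Hausdorff cover\<close>

definition fell_topology :: "'g::topological_space set topology" where
  "fell_topology = topology_generated_by
     {{F. closed F \<and> (\<forall>U\<in>\<U>. F \<inter> U \<noteq> {}) \<and> F \<inter> K = {}} | \<U> K.
        finite \<U> \<and> (\<forall>U\<in>\<U>. open U) \<and> compact K}"

definition iota :: "'g \<Rightarrow> 'g set" where
  "iota g = {g}"

definition hausdorff_cover :: "'g::topological_space set set" where
  "hausdorff_cover = subtopology fell_topology {F. F \<noteq> {}} closure_of range iota"

definition hausdorff_cover_topology :: "'g::topological_space set topology" where
  "hausdorff_cover_topology = subtopology fell_topology hausdorff_cover"

definition cover_src :: "'g groupoid_ops \<Rightarrow> 'g set \<Rightarrow> 'g set" where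
  "cover_src G \<gamma> = {gmult G (ginv G g\<^sub>1) g\<^sub>2 | g\<^sub>1 g\<^sub>2. g\<^sub>1 \<in> \<gamma> \<and> g\<^sub>2 \<in> \<gamma>}"

definition cover_rng :: "'g groupoid_ops \<Rightarrow> 'g set \<Rightarrow> 'g set" where
  "cover_rng G \<gamma> = {gmult G g\<^sub>1 (ginv G g\<^sub>2) | g\<^sub>1 g\<^sub>2. g\<^sub>1 \<in> \<gamma> \<and> g\<^sub>2 \<in> \<gamma>}"

definition cover_units :: "'g::topological_space groupoid_ops \<Rightarrow> 'g set set" where
  "cover_units G = hausdorff_cover_topology closure_of (iota ` units G)"

text \<open>Only the values of \<open>f\<close> on \<open>hausdorff_cover\<close> matter.\<close>

definition decomposable :: "('g::topological_space set \<Rightarrow> complex) \<Rightarrow> bool" where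
  "decomposable f \<longleftrightarrow> (\<forall>\<gamma>\<in>hausdorff_cover.
     finite {g \<in> \<gamma>. f (iota g) \<noteq> 0} \<and> f \<gamma> = (\<Sum>g | g \<in> \<gamma> \<and> f (iota g) \<noteq> 0. f (iota g)))"


section \<open>The essential part\<close>

definition dangerous_units :: "'g::topological_space groupoid_ops \<Rightarrow> 'g set" where
  "dangerous_units G = src G ` (closure (units G) - units G)"

definition ess_cover_units :: "'g::topological_space groupoid_ops \<Rightarrow> 'g set set" where
  "ess_cover_units G =
     subtopology hausdorff_cover_topology (cover_units G)
       closure_of (iota ` (units G - dangerous_units G))"

definition ess_cover :: "'g::topological_space groupoid_ops \<Rightarrow> 'g set set" where
  "ess_cover G = {\<gamma> \<in> hausdorff_cover.
     cover_rng G \<gamma> \<in> ess_cover_units G \<and> cover_src G \<gamma> \<in> ess_cover_units G}"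

end

theory Submission
  imports Defs
begin

text \<open>Let \<open>f\<close> be the function of an element of the singular ideal; it is a uniform limit of functions
  in \<open>Cc G\<close>.  A function \<open>\<phi>\<close> in \<open>Cc G\<close> satisfies \<open>\<phi> c \<longlongrightarrow> (\<Sum>h\<in>\<gamma>. \<phi> h)\<close> as \<open>{c} \<longlongrightarrow> \<gamma>\<close> in the Fell topology.
  An element \<open>g\<close> whose source is not dangerous is separated from all other elements, so \<open>c \<longlongrightarrow> g\<close>
  implies \<open>{c} \<longlongrightarrow> {g}\<close>; hence \<open>f\<close> is continuous at \<open>g\<close>, and singularity forces \<open>f g = 0\<close>.  Every \<open>\<gamma>\<close> in the
  essential part is a Fell limit of such elements, so \<open>(\<Sum>h\<in>\<gamma>. f h) = 0\<close> there.  As the sets \<open>\<gamma>\<close> are finite,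
  these sums define a decomposable function, which vanishes by assumption, and so does \<open>f\<close>.  Since
  \<open>\<langle>T\<^sub>x \<delta>\<^sub>h, \<delta>\<^sub>g\<rangle> = f (g h\<^sup>-\<^sup>1)\<close>, the operators \<open>T\<^sub>x\<close> vanish as well.\<close>

section \<open>Etale groupoids\<close>

context groupoid
begin

lemma inv_inv: "ginv G (ginv G g) = g"
proof -
  have "ginv G (ginv G g) = gmult G (ginv G (ginv G g)) (gmult G (ginv G g) g)"
    by (metis inv_mult mult_src rng_inv src_inv)
  also have "\<dots> = gmult G (gmult G (ginv G (ginv G g)) (ginv G g)) g"
    by (simp add: mult_assoc rng_inv src_inv)
  also have "\<dots> = g"
    by (metis inv_mult rng_mult_left src_inv)
  finally show ?thesis .
qed

lemma inv_mult_cancel: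
  assumes "rng G g = rng G h"
  shows "gmult G g (gmult G (ginv G g) h) = h"
  using mult_assoc[of g "ginv G g" h] assms
  by (simp add: rng_inv src_inv mult_inv rng_mult_left)

lemma mult_inv_cancel:
  assumes "src G g = src G h"
  shows "gmult G (gmult G g (ginv G h)) h = g"
  using mult_assoc[of g "ginv G h" h] assms
  by (metis inv_mult mult_src rng_inv src_inv)

lemma mult_cancel_inv:
  assumes "src G g = rng G h"
  shows "gmult G (gmult G g h) (ginv G h) = g"
  using mult_assoc[of g h "ginv G h"] assms
  by (metis mult_inv mult_src rng_inv)

lemma units_iff: "x \<in> units G \<longleftrightarrow> src G x = x"
  by (metis rangeE rangeI src_src units_def)

lemma rng_unit: "x \<in> units G \<Longrightarrow> rng G x = x"
  by (metis rng_src units_iff)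

lemma src_in_units: "src G g \<in> units G" and rng_in_units: "rng G g \<in> units G"
  by (simp_all add: src_src src_rng units_iff)

lemma inv_unit: "x \<in> units G \<Longrightarrow> ginv G x = x"
  by (metis inv_mult mult_src rng_unit src_inv units_iff)

end

section \<open>Separation and compactness from Hausdorff units\<close>

lemma (in topological_groupoid) open_inv_image: "open V \<Longrightarrow> open (ginv G ` V)"
proof -
  assume "open V"
  moreover have "ginv G ` V = ginv G -` V"
    by (force simp: inv_inv intro: rev_image_eqI)
  ultimately show ?thesis
    using continuous_inv by (simp add: continuous_on_open_vimage)
qed

text \<open>Continuity is available on composable pairs alone, so the rectangle
  \<open>A \<times> B\<close> controls the product only for those pairs.\<close>

lemma (in topological_groupoid) mult_neighbourhoods:
  assumes "src G g = rng G h" "open W" "gmult G g h \<in> W"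
  obtains A B where "open A" "g \<in> A" "open B" "h \<in> B"
    "\<forall>a\<in>A. \<forall>b\<in>B. src G a = rng G b \<longrightarrow> gmult G a b \<in> W"
proof -
  have "(g, h) \<in> composable G"
    using assms by (simp add: composable_def)
  then have "\<exists>S. open S \<and> (g, h) \<in> S \<and>
      (\<forall>p\<in>composable G. p \<in> S \<longrightarrow> (\<lambda>(g, h). gmult G g h) p \<in> W)"
    using continuous_mult[unfolded continuous_on_topological, rule_format, of "(g, h)" W] assms(2,3)
    by simp
  then obtain S where "open S" "(g, h) \<in> S"
    and S: "\<And>p. p \<in> composable G \<Longrightarrow> p \<in> S \<Longrightarrow> (\<lambda>(g, h). gmult G g h) p \<in> W"
    by blast
  then obtain A B where "open A" "open B" "g \<in> A" "h \<in> B" "A \<times> B \<subseteq> S"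
    using open_prod_elim by (metis mem_Sigma_iff)
  moreover have "gmult G a b \<in> W" if "a \<in> A" "b \<in> B" "src G a = rng G b" for a b
    using S[of "(a, b)"] that \<open>A \<times> B \<subseteq> S\<close> by (auto simp: composable_def)
  ultimately show ?thesis
    using that by blast
qed

lemma (in topological_groupoid) separate_units:
  assumes "x \<in> units G" "y \<in> units G" "x \<noteq> y"
  obtains A B where "open A" "open B" "x \<in> A" "y \<in> B" "A \<inter> B \<inter> units G = {}"
proof -
  obtain A B where "openin (top_of_set (units G)) A" "openin (top_of_set (units G)) B"
    "x \<in> A" "y \<in> B" "disjnt A B"
    using Hausdorff_units assms unfolding Hausdorff_space_def by (metis topspace_euclidean_subtopology)
  then obtain A' B' where "open A'" "open B'" "A = units G \<inter> A'" "B = units G \<inter> B'"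
    by (metis openin_open)
  with \<open>disjnt A B\<close> \<open>x \<in> A\<close> \<open>y \<in> B\<close> show ?thesis
    by (intro that[of A' B']) (auto simp: disjnt_def)
qed

lemma (in topological_groupoid) open_vimage_src: "open V \<Longrightarrow> open (src G -` V)"
  and open_vimage_rng: "open V \<Longrightarrow> open (rng G -` V)"
  using continuous_src continuous_rng by (simp_all add: continuous_on_open_vimage)

text \<open>The groupoid need not be Hausdorff, but its units are: neighbourhoods of the two ranges
  that are disjoint within the units pull back to disjoint sets.\<close>

lemma (in topological_groupoid) separate_by_rng:
  assumes "rng G g \<noteq> rng G h"
  obtains A B where "open A" "open B" "g \<in> A" "h \<in> B" "A \<inter> B = {}"
proof -
  obtain A B where "open A" "open B" "rng G g \<in> A" "rng G h \<in> B" "A \<inter> B \<inter> units G = {}"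
    by (rule separate_units[OF rng_in_units rng_in_units assms])
  moreover from this have "rng G -` A \<inter> rng G -` B = {}"
    using rng_in_units by blast
  ultimately show ?thesis
    using that[of "rng G -` A" "rng G -` B"] open_vimage_rng by simp
qed

lemma (in topological_groupoid) separate_by_src:
  assumes "src G g \<noteq> src G h"
  obtains A B where "open A" "open B" "g \<in> A" "h \<in> B" "A \<inter> B = {}"
proof -
  obtain A B where "open A" "open B" "src G g \<in> A" "src G h \<in> B" "A \<inter> B \<inter> units G = {}"
    by (rule separate_units[OF src_in_units src_in_units assms])
  moreover from this have "src G -` A \<inter> src G -` B = {}"
    using src_in_units by blast
  ultimately show ?thesis
    using that[of "src G -` A" "src G -` B"] open_vimage_src by simp
qed

text \<open>As the units are Hausdorff, having equal ranges is a closed condition on pairs, and it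
  cuts a compact set out of the compact product.\<close>

lemma (in topological_groupoid) compact_fibre_product:
  assumes "compact L" "compact K"
  shows "compact ((L \<times> K) \<inter> {p. rng G (fst p) = rng G (snd p)})"
proof -
  have "open (- {p. rng G (fst p) = rng G (snd p)})"
  proof (rule open_subopen[THEN iffD2], rule ballI)
    fix p assume "p \<in> - {p. rng G (fst p) = rng G (snd p)}"
    then have "rng G (fst p) \<noteq> rng G (snd p)"
      by simp
    then obtain A B where "open A" "open B" "rng G (fst p) \<in> A" "rng G (snd p) \<in> B"
      and disj: "A \<inter> B \<inter> units G = {}"
      by (rule separate_units[OF rng_in_units rng_in_units])
    then have "open ((rng G -` A) \<times> (rng G -` B))" "p \<in> (rng G -` A) \<times> (rng G -` B)"
      by (simp_all add: open_Times open_vimage_rng mem_Times_iff)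
    moreover have "rng G (fst q) \<noteq> rng G (snd q)" if "q \<in> (rng G -` A) \<times> (rng G -` B)" for q
      using that rng_in_units[of "fst q"] disj by (auto simp: mem_Times_iff)
    ultimately show "\<exists>T. open T \<and> p \<in> T \<and> T \<subseteq> - {p. rng G (fst p) = rng G (snd p)}"
      by blast
  qed
  then show ?thesis
    using compact_Int_closed[OF compact_Times[OF assms]] by (simp add: closed_def)
qed

text \<open>A continuous image of a compact fibre product. It serves to turn avoidance of
  \<open>K\<close> by an element of the cover into avoidance of a compact set by its source.\<close>

lemma (in topological_groupoid) compact_inv_mult:
  assumes "compact L" "compact K"
  shows "compact {gmult G (ginv G l) k | l k. l \<in> L \<and> k \<in> K \<and> rng G l = rng G k}"
proof -
  let ?P = "(L \<times> K) \<inter> {p. rng G (fst p) = rng G (snd p)}"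
  have "continuous_on ?P (\<lambda>p. (ginv G (fst p), snd p))"
    by (intro continuous_on_Pair continuous_on_compose2[OF continuous_inv]
        continuous_on_fst continuous_on_snd continuous_on_id) auto
  then have "continuous_on ?P (\<lambda>p. (\<lambda>(g, h). gmult G g h) (ginv G (fst p), snd p))"
    by (rule continuous_on_compose2[OF continuous_mult]) (auto simp: composable_def src_inv)
  then have "compact ((\<lambda>p. (\<lambda>(g, h). gmult G g h) (ginv G (fst p), snd p)) ` ?P)"
    using compact_fibre_product[OF assms] compact_continuous_image by blast
  moreover have "(\<lambda>p. (\<lambda>(g, h). gmult G g h) (ginv G (fst p), snd p)) ` ?P
      = {gmult G (ginv G l) k | l k. l \<in> L \<and> k \<in> K \<and> rng G l = rng G k}"
    by (fastforce intro: rev_image_eqI[of "(_, _)"])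
  ultimately show ?thesis
    by simp
qed

section \<open>Local structure of etale groupoids\<close>

context etale_groupoid
begin

lemma open_map_rng:
  assumes "open V"
  shows "openin (top_of_set (units G)) (rng G ` V)"
  unfolding openin_subopen[of _ "rng G ` V"]
proof
  fix x assume "x \<in> rng G ` V"
  then obtain g where g: "g \<in> V" "x = rng G g" by blast
  obtain U h where U: "open U" "g \<in> U" "openin (top_of_set (units G)) (rng G ` U)"
    "homeomorphism U (rng G ` U) (rng G) h"
    using etale by blast
  have "openin (top_of_set (rng G ` U)) (rng G ` (U \<inter> V))"
    using homeomorphism_imp_open_map[OF U(4)] assms by (simp add: openin_open_Int)
  with U(3) have "openin (top_of_set (units G)) (rng G ` (U \<inter> V))"
    using openin_trans by blast
  with g U(2) show "\<exists>T. openin (top_of_set (units G)) T \<and> x \<in> T \<and> T \<subseteq> rng G ` V"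
    by blast
qed

lemma src_image_eq: "src G ` V = rng G ` ginv G ` V"
  by (simp add: image_image rng_inv)

lemma open_map_src: "open V \<Longrightarrow> openin (top_of_set (units G)) (src G ` V)"
  by (simp add: src_image_eq open_map_rng open_inv_image)

text \<open>Inversion exchanges source and range, so injectivity of \<open>rng G\<close> near
  \<open>ginv G g\<close> transfers.\<close>

lemma src_locally_inj:
  obtains U where "open U" "g \<in> U" "inj_on (src G) U"
proof -
  obtain U h where U: "open U" "ginv G g \<in> U" "homeomorphism U (rng G ` U) (rng G) h"
    using etale by blast
  have "inj_on (rng G) U"
    by (rule inj_on_inverseI[of U h]) (rule homeomorphism_apply1[OF U(3)])
  then have "inj_on (src G) (ginv G ` U)"
    by (auto simp: inj_on_def src_inv)
  moreover have "g \<in> ginv G ` U"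
    using U(2) inv_inv[of g] by (metis imageI)
  ultimately show ?thesis
    using that open_inv_image[OF U(1)] by blast
qed

text \<open>Without the Hausdorff property, local compactness provides some compact neighbourhood,
  not small ones. Small ones exist in the Hausdorff space of units, and a local inverse of
  \<open>rng G\<close> carries them back into \<open>W\<close>.\<close>

lemma compact_neighbourhood:
  fixes g :: 'g
  assumes "open W" "g \<in> W"
  obtains V K where "open V" "compact K" "g \<in> V" "V \<subseteq> K" "K \<subseteq> W"
proof -
  let ?X = "top_of_set (units G)"
  \<comment> \<open>The map \<open>rng G\<close> is continuous, open and fixes units, so it pushes a
    compact neighbourhood of a unit into the units.\<close>
  have "locally_compact_space ?X"
    unfolding locally_compact_space_def
  proof
    fix x assume "x \<in> topspace ?X"
    then have x: "x \<in> units G" by simp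
    have "\<exists>V K. open V \<and> compact K \<and> x \<in> V \<and> V \<subseteq> K"
      using locally_compact unfolding locally_compact_space_def by simp
    then obtain V K where "open V" "compact K" "x \<in> V" "V \<subseteq> K"
      by blast
    moreover have "compact (rng G ` K)"
      using compact_continuous_image[OF continuous_on_subset[OF continuous_rng]] \<open>compact K\<close> by blast
    moreover have "x \<in> rng G ` V"
      using \<open>x \<in> V\<close> rng_unit[OF x] by (metis imageI)
    moreover have "rng G ` K \<subseteq> units G"
      using rng_in_units by blast
    ultimately have "openin ?X (rng G ` V) \<and> compactin ?X (rng G ` K) \<and> x \<in> rng G ` V
        \<and> rng G ` V \<subseteq> rng G ` K"
      by (simp add: open_map_rng compactin_subtopology image_mono)
    then show "\<exists>U K. openin ?X U \<and> compactin ?X K \<and> x \<in> U \<and> U \<subseteq> K"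
      by blast
  qed
  then have nb: "neighbourhood_base_of (compactin ?X) ?X"
    using Hausdorff_units locally_compact_space_neighbourhood_base by blast
  obtain U h where U: "open U" "g \<in> U" "homeomorphism U (rng G ` U) (rng G) h"
    using etale by blast
  have "openin ?X (rng G ` (U \<inter> W))" "rng G g \<in> rng G ` (U \<inter> W)"
    using U(1,2) assms by (simp_all add: open_map_rng open_Int)
  then obtain u k where uk: "openin ?X u" "compactin ?X k" "rng G g \<in> u" "u \<subseteq> k"
    "k \<subseteq> rng G ` (U \<inter> W)"
    using nb unfolding neighbourhood_base_of by metis
  obtain u' where u': "open u'" "u = units G \<inter> u'"
    using uk(1) by (metis openin_open)
  have "compact k"
    using uk(2) by (simp add: compactin_subtopology)
  moreover have "continuous_on k h"
    by (rule continuous_on_subset[OF homeomorphism_cont2[OF U(3)]]) (use uk(5) in blast)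
  ultimately have "compact (h ` k)"
    using compact_continuous_image by blast
  moreover have "h ` k \<subseteq> W"
    using uk(5) homeomorphism_apply1[OF U(3)] by fastforce
  moreover have "U \<inter> rng G -` u' \<subseteq> h ` k"
  proof
    fix a assume "a \<in> U \<inter> rng G -` u'"
    then have "rng G a \<in> k" "h (rng G a) = a"
      using u' uk(4) homeomorphism_apply1[OF U(3), of a] rng_in_units[of a] by auto
    then show "a \<in> h ` k" by force
  qed
  moreover have "open (U \<inter> rng G -` u')" "g \<in> U \<inter> rng G -` u'"
    using U(1,2) u' uk(3) open_vimage_rng[of u'] by (simp_all add: open_Int)
  ultimately show ?thesis
    using that by simp
qed

text \<open>Points with different sources can be separated, and a neighbourhood on which
  \<open>src G\<close> is injective has no second point with the same source. The Fell space
  consists of closed sets, so this places \<open>iota g\<close> in it.\<close>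

lemma closed_singleton: "closed {g :: 'g}"
  unfolding closed_def
proof (rule open_subopen[THEN iffD2], rule ballI)
  fix h assume "h \<in> - {g}"
  then have "h \<noteq> g" by simp
  show "\<exists>T. open T \<and> h \<in> T \<and> T \<subseteq> - {g}"
  proof (cases "src G h = src G g")
    case True
    obtain U where "open U" "h \<in> U" "inj_on (src G) U"
      using src_locally_inj by blast
    with True \<open>h \<noteq> g\<close> show ?thesis
      by (intro exI[of _ U]) (auto simp: inj_on_def)
  next
    case False
    then show ?thesis
      by (rule separate_by_src) blast
  qed
qed

text \<open>If \<open>g\<close> and \<open>h\<close> have equal source and range and cannot be
  separated, then \<open>gmult G (ginv G h) g\<close> is a limit of units without being a unit, so
  its source, which is that of \<open>g\<close>, is dangerous.\<close>

lemma separate_nondangerous: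
  assumes "src G g \<notin> dangerous_units G" "h \<noteq> g"
  obtains A B where "open A" "open B" "g \<in> A" "h \<in> B" "A \<inter> B = {}"
proof (cases "src G g = src G h \<and> rng G g = rng G h")
  case False
  then consider "src G g \<noteq> src G h" | "rng G g \<noteq> rng G h"
    by blast
  then show ?thesis
    by cases (erule separate_by_src separate_by_rng, erule (4) that)+
next
  case True
  let ?k = "gmult G (ginv G h) g"
  have "?k \<notin> units G"
    using True assms(2) inv_mult_cancel[of h g] src_mult[of "ginv G h" g]
    by (metis mult_src src_inv units_iff)
  moreover have "src G ?k = src G g"
    using True by (simp add: src_mult src_inv)
  ultimately have "?k \<notin> closure (units G)"
    using assms(1) unfolding dangerous_units_def by (metis DiffI imageI)
  then have k: "?k \<in> - closure (units G)"
    by simp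
  have "src G (ginv G h) = rng G g"
    using True by (simp add: src_inv)
  then obtain B' A where BA: "open B'" "ginv G h \<in> B'" "open A" "g \<in> A"
    "\<forall>b\<in>B'. \<forall>a\<in>A. src G b = rng G a \<longrightarrow> gmult G b a \<in> - closure (units G)"
    by (rule mult_neighbourhoods[OF _ open_Compl[OF closed_closure] k])
  \<comment> \<open>An element \<open>ginv G b\<close> of both sets would put the unit
    \<open>gmult G b (ginv G b)\<close> outside the closure of the units.\<close>
  have "A \<inter> ginv G ` B' = {}"
  proof (rule ccontr)
    assume "A \<inter> ginv G ` B' \<noteq> {}"
    then obtain b where b: "b \<in> B'" "ginv G b \<in> A" by blast
    then have "rng G b \<in> - closure (units G)"
      using BA(5)[rule_format, of b "ginv G b"] by (simp add: rng_inv mult_inv)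
    then show False
      using rng_in_units[of b] closure_subset[of "units G"] by blast
  qed
  moreover have "h \<in> ginv G ` B'"
    using BA(2) by (metis imageI inv_inv)
  ultimately show ?thesis
    using that[of A "ginv G ` B'"] BA(1,3,4) open_inv_image[OF BA(1)] by simp
qed

text \<open>Compact sets need not be closed; separation of \<open>g\<close> from each point of
  \<open>K\<close> and a finite subcover make up for it.\<close>

lemma compact_avoid_nondangerous:
  assumes "src G g \<notin> dangerous_units G" "compact K" "g \<notin> K"
  obtains V where "open V" "g \<in> V" "V \<inter> K = {}"
proof -
  have "\<forall>k\<in>K. \<exists>A B. open A \<and> open B \<and> g \<in> A \<and> k \<in> B \<and> A \<inter> B = {}"
  proof
    fix k assume "k \<in> K"
    with assms(3) have "k \<noteq> g" by blast
    with assms(1) show "\<exists>A B. open A \<and> open B \<and> g \<in> A \<and> k \<in> B \<and> A \<inter> B = {}"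
      by (rule separate_nondangerous) blast
  qed
  then obtain A B where AB: "\<And>k. k \<in> K \<Longrightarrow> open (A k) \<and> open (B k) \<and> g \<in> A k \<and> k \<in> B k \<and> A k \<inter> B k = {}"
    by metis
  obtain D where D: "D \<subseteq> K" "finite D" "K \<subseteq> (\<Union>k\<in>D. B k)"
    by (rule compactE_image[OF assms(2), of K B]) (use AB in auto)
  have "open (\<Inter>k\<in>D. A k)"
    using D AB by (intro open_INT) auto
  moreover have "g \<in> (\<Inter>k\<in>D. A k)"
    using D AB by blast
  moreover have "(\<Inter>k\<in>D. A k) \<inter> K = {}"
    using D AB by blast
  ultimately show ?thesis
    using that by blast
qed

end

section \<open>Fell convergence\<close>

text \<open>Convergence of \<open>{g}\<close> to \<open>\<gamma>\<close> in the Fell topology, as a filter on the groupoid itself.\<close>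

definition fell_filter :: "'g::topological_space set \<Rightarrow> 'g filter" where
  "fell_filter \<gamma> = (INF W\<in>{U. open U \<and> \<gamma> \<inter> U \<noteq> {}} \<union> uminus ` {K. compact K \<and> \<gamma> \<inter> K = {}}. principal W)"

lemma eventually_fell_filter_open:
  assumes "open U" "g \<in> \<gamma>" "g \<in> U"
  shows "eventually (\<lambda>c. c \<in> U) (fell_filter \<gamma>)"
proof -
  have "fell_filter \<gamma> \<le> principal U"
    unfolding fell_filter_def by (rule INF_lower) (use assms in blast)
  then show ?thesis
    by (simp add: le_principal)
qed

lemma eventually_fell_filter_compact:
  assumes "compact K" "\<gamma> \<inter> K = {}"
  shows "eventually (\<lambda>c. c \<notin> K) (fell_filter \<gamma>)"
proof -
  have "fell_filter \<gamma> \<le> principal (- K)"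
    unfolding fell_filter_def by (rule INF_lower) (use assms in blast)
  then show ?thesis
    by (simp add: le_principal)
qed

lemma le_fell_filterI:
  assumes "\<And>U h. open U \<Longrightarrow> h \<in> \<gamma> \<Longrightarrow> h \<in> U \<Longrightarrow> eventually (\<lambda>c. c \<in> U) F"
    and "\<And>K. compact K \<Longrightarrow> \<gamma> \<inter> K = {} \<Longrightarrow> eventually (\<lambda>c. c \<notin> K) F"
  shows "F \<le> fell_filter \<gamma>"
  unfolding fell_filter_def
proof (rule INF_greatest)
  fix W assume "W \<in> {U. open U \<and> \<gamma> \<inter> U \<noteq> {}} \<union> uminus ` {K. compact K \<and> \<gamma> \<inter> K = {}}"
  then have "eventually (\<lambda>c. c \<in> W) F"
    using assms by auto
  then show "F \<le> principal W"
    by (simp add: le_principal)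
qed

lemma fell_filter_le_nhds:
  assumes "h \<in> \<gamma>"
  shows "fell_filter \<gamma> \<le> nhds h"
  unfolding nhds_def
proof (rule INF_greatest)
  fix S assume "S \<in> {S. open S \<and> h \<in> S}"
  then show "fell_filter \<gamma> \<le> principal S"
    using eventually_fell_filter_open[of S h \<gamma>] assms by (simp add: le_principal)
qed

section \<open>Fell closures in terms of filters\<close>

lemma openin_fell_basic:
  assumes "finite \<U>" "\<forall>U\<in>\<U>. open U" "compact K"
  shows "openin fell_topology {F. closed F \<and> (\<forall>U\<in>\<U>. F \<inter> U \<noteq> {}) \<and> F \<inter> K = {}}"
  unfolding fell_topology_def by (rule topology_generated_by_Basis) (use assms in blast)

lemma topspace_fell: "topspace fell_topology = {F. closed F}"
proof
  show "topspace fell_topology \<subseteq> {F :: 'a set. closed F}"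
    unfolding fell_topology_def topology_generated_by_topspace by blast
  show "{F :: 'a set. closed F} \<subseteq> topspace fell_topology"
    using openin_subset[OF openin_fell_basic[of "{}" "{}"]] by simp
qed

text \<open>Finitely many generators of \<open>fell_filter \<gamma>\<close> correspond to finitely
  many Fell-open sets around \<open>\<gamma>\<close>, whose intersection contains some
  \<open>iota c\<close> with \<open>c\<close> in \<open>S\<close>.\<close>

lemma fell_filter_closure_nontrivial:
  assumes "\<gamma> \<in> fell_topology closure_of (iota ` S)"
  shows "inf (fell_filter \<gamma>) (principal S) \<noteq> bot"
proof
  assume "inf (fell_filter \<gamma>) (principal S) = bot"
  then have "eventually (\<lambda>c. c \<notin> S) (fell_filter \<gamma>)"
    using eventually_inf_principal[of "\<lambda>_. False" "fell_filter \<gamma>" S] by simp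
  then have "\<exists>X\<subseteq>{U. open U \<and> \<gamma> \<inter> U \<noteq> {}} \<union> uminus ` {K. compact K \<and> \<gamma> \<inter> K = {}}.
      finite X \<and> eventually (\<lambda>c. c \<notin> S) (INF W\<in>X. principal W)"
    unfolding fell_filter_def by (rule eventually_INF[THEN iffD1])
  then obtain X where X: "finite X"
    "X \<subseteq> {U. open U \<and> \<gamma> \<inter> U \<noteq> {}} \<union> uminus ` {K. compact K \<and> \<gamma> \<inter> K = {}}"
    "eventually (\<lambda>c. c \<notin> S) (INF W\<in>X. principal W)"
    by (elim exE conjE)
  have XS: "c \<notin> S" if "\<forall>W\<in>X. c \<in> W" for c
    using X(3) that unfolding INF_principal_finite[OF X(1)] by (simp add: eventually_principal)
  have "closed \<gamma>"
    using subsetD[OF closure_of_subset_topspace assms] by (simp add: topspace_fell)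
  \<comment> \<open>An open generator is handled with the empty compact set, the complement of a
    compact set with the empty family of open sets.\<close>
  have "\<exists>N. openin fell_topology N \<and> \<gamma> \<in> N \<and> (\<forall>c. iota c \<in> N \<longrightarrow> c \<in> W)" if "W \<in> X" for W
  proof (cases "open W \<and> \<gamma> \<inter> W \<noteq> {}")
    case True
    then show ?thesis
      using openin_fell_basic[of "{W}" "{}"] \<open>closed \<gamma>\<close>
      by (intro exI[of _ "{F. closed F \<and> (\<forall>U\<in>{W}. F \<inter> U \<noteq> {}) \<and> F \<inter> {} = {}}"])
        (simp add: iota_def)
  next
    case False
    then have "W \<in> uminus ` {K. compact K \<and> \<gamma> \<inter> K = {}}"
      using subsetD[OF X(2) that] by simp argo
    then obtain K where "W = - K" "compact K" "\<gamma> \<inter> K = {}"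
      by blast
    then show ?thesis
      using openin_fell_basic[of "{}" K] \<open>closed \<gamma>\<close>
      by (intro exI[of _ "{F. closed F \<and> (\<forall>U\<in>{}. F \<inter> U \<noteq> {}) \<and> F \<inter> K = {}}"])
        (simp add: iota_def)
  qed
  then obtain N where N: "\<And>W. W \<in> X \<Longrightarrow> openin fell_topology (N W)"
    "\<And>W. W \<in> X \<Longrightarrow> \<gamma> \<in> N W" "\<And>W c. W \<in> X \<Longrightarrow> iota c \<in> N W \<Longrightarrow> c \<in> W"
    by metis
  \<comment> \<open>The factor \<open>topspace fell_topology\<close> keeps the intersection
    Fell-open also when \<open>X\<close> is empty.\<close>
  have "openin fell_topology ((\<Inter>W\<in>X. N W) \<inter> topspace fell_topology)"
    by (rule openin_INT) (use X(1) N(1) in auto)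
  moreover have "\<gamma> \<in> (\<Inter>W\<in>X. N W) \<inter> topspace fell_topology"
    using N(2) \<open>closed \<gamma>\<close> by (simp add: topspace_fell)
  ultimately have "\<exists>y. y \<in> iota ` S \<and> y \<in> (\<Inter>W\<in>X. N W) \<inter> topspace fell_topology"
    using assms unfolding in_closure_of by metis
  then show False
    using XS N(3) by blast
qed

lemma hausdorff_cover_closure: "\<gamma> \<in> hausdorff_cover \<Longrightarrow> \<gamma> \<in> fell_topology closure_of range iota"
  unfolding hausdorff_cover_def by (rule subsetD[OF closure_of_subtopology_subset])

lemma hausdorff_cover_closed: "\<gamma> \<in> hausdorff_cover \<Longrightarrow> closed \<gamma>"
  using subsetD[OF closure_of_subset_topspace hausdorff_cover_closure] by (auto simp: topspace_fell)

lemma hausdorff_cover_nonempty: "\<gamma> \<in> hausdorff_cover \<Longrightarrow> \<gamma> \<noteq> {}"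
  unfolding hausdorff_cover_def
  using closure_of_subset_topspace[of "subtopology fell_topology {F. F \<noteq> {}}" "range iota"] by auto

lemma hausdorff_cover_nontrivial: "\<gamma> \<in> hausdorff_cover \<Longrightarrow> fell_filter \<gamma> \<noteq> bot"
  using fell_filter_closure_nontrivial[OF hausdorff_cover_closure] by auto

lemma ess_cover_units_closure:
  "\<gamma> \<in> ess_cover_units G \<Longrightarrow> \<gamma> \<in> fell_topology closure_of (iota ` (units G - dangerous_units G))"
  unfolding ess_cover_units_def hausdorff_cover_topology_def
  by (rule subsetD[OF closure_of_subtopology_subset[of fell_topology hausdorff_cover]])
    (rule subsetD[OF closure_of_subtopology_subset])

section \<open>Elements of the Hausdorff cover as limits\<close>

context etale_groupoid
begin

lemma iota_in_hausdorff_cover: "iota (g :: 'g) \<in> hausdorff_cover"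
proof -
  have "iota g \<in> topspace (subtopology fell_topology {F. F \<noteq> {}})"
    using closed_singleton[of g] by (simp add: topspace_fell iota_def)
  then show ?thesis
    unfolding hausdorff_cover_def
    using closure_of_subset_Int[of "subtopology fell_topology {F. F \<noteq> {}}" "range iota"] by blast
qed

text \<open>Both \<open>g\<close> and \<open>h\<close> are limits of the same proper filter
  \<open>fell_filter \<gamma>\<close>.\<close>

lemma hausdorff_cover_not_separated:
  assumes "\<gamma> \<in> hausdorff_cover" "g \<in> \<gamma>" "h \<in> \<gamma>" "open A" "open B" "g \<in> A" "h \<in> B"
  shows "A \<inter> B \<noteq> {}"
proof
  assume "A \<inter> B = {}"
  have "eventually (\<lambda>c. c \<in> A \<and> c \<in> B) (fell_filter \<gamma>)"
    using assms by (intro eventually_conj eventually_fell_filter_open)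
  then show False
    using \<open>A \<inter> B = {}\<close> hausdorff_cover_nontrivial[OF assms(1)]
    by (auto simp: disjoint_iff dest: eventually_happens')
qed

lemma hausdorff_cover_src:
  assumes "\<gamma> \<in> hausdorff_cover" "g \<in> \<gamma>" "h \<in> \<gamma>"
  shows "src G g = src G h"
proof (rule ccontr)
  assume "src G g \<noteq> src G h"
  then obtain A B where "open A" "open B" "g \<in> A" "h \<in> B" "A \<inter> B = {}"
    by (rule separate_by_src)
  then show False
    using hausdorff_cover_not_separated[OF assms] by blast
qed

lemma hausdorff_cover_rng:
  assumes "\<gamma> \<in> hausdorff_cover" "g \<in> \<gamma>" "h \<in> \<gamma>"
  shows "rng G g = rng G h"
proof (rule ccontr)
  assume "rng G g \<noteq> rng G h"
  then obtain A B where "open A" "open B" "g \<in> A" "h \<in> B" "A \<inter> B = {}"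
    by (rule separate_by_rng)
  then show False
    using hausdorff_cover_not_separated[OF assms] by blast
qed

text \<open>If \<open>c\<close> converges to every element of \<open>\<gamma>\<close>, then \<open>c = c c\<^sup>-\<^sup>1 c\<close> also converges to
  \<open>g\<^sub>1 g\<^sub>2\<^sup>-\<^sup>1 g\<^sub>3\<close>, and \<open>\<gamma>\<close> contains all limits.\<close>

lemma hausdorff_cover_ternary:
  assumes \<gamma>: "\<gamma> \<in> hausdorff_cover" and g: "g\<^sub>1 \<in> \<gamma>" "g\<^sub>2 \<in> \<gamma>" "g\<^sub>3 \<in> \<gamma>"
  shows "gmult G g\<^sub>1 (gmult G (ginv G g\<^sub>2) g\<^sub>3) \<in> \<gamma>"
proof (rule ccontr)
  let ?k = "gmult G (ginv G g\<^sub>2) g\<^sub>3"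
  assume "gmult G g\<^sub>1 ?k \<notin> \<gamma>"
  then have "gmult G g\<^sub>1 ?k \<in> - \<gamma>" "open (- \<gamma>)"
    using hausdorff_cover_closed[OF \<gamma>] by auto
  \<comment> \<open>Eventually \<open>c\<close> avoids \<open>K\<close>, although continuity of the
    product will force \<open>c\<close> into \<open>V\<close>, a subset of \<open>K\<close>.\<close>
  then obtain V K where VK: "open V" "compact K" "gmult G g\<^sub>1 ?k \<in> V" "V \<subseteq> K" "K \<subseteq> - \<gamma>"
    using compact_neighbourhood by blast
  have 2: "src G (ginv G g\<^sub>2) = rng G g\<^sub>3"
    using hausdorff_cover_rng[OF \<gamma> g(2,3)] by (simp add: src_inv)
  have "src G g\<^sub>1 = rng G ?k"
    using hausdorff_cover_src[OF \<gamma> g(1,2)] 2 by (simp add: rng_mult rng_inv)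
  then obtain A\<^sub>1 B where A1: "open A\<^sub>1" "g\<^sub>1 \<in> A\<^sub>1" "open B" "?k \<in> B"
    "\<forall>a\<in>A\<^sub>1. \<forall>b\<in>B. src G a = rng G b \<longrightarrow> gmult G a b \<in> V"
    by (rule mult_neighbourhoods[OF _ VK(1,3)])
  obtain A\<^sub>2 A\<^sub>3 where A2: "open A\<^sub>2" "ginv G g\<^sub>2 \<in> A\<^sub>2" "open A\<^sub>3" "g\<^sub>3 \<in> A\<^sub>3"
    "\<forall>a\<in>A\<^sub>2. \<forall>b\<in>A\<^sub>3. src G a = rng G b \<longrightarrow> gmult G a b \<in> B"
    by (rule mult_neighbourhoods[OF 2 A1(3,4)])
  have "g\<^sub>2 \<in> ginv G ` A\<^sub>2"
    using A2(2) inv_inv[of g\<^sub>2] by (metis imageI)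
  then have "eventually (\<lambda>c. c \<in> A\<^sub>1 \<and> c \<in> ginv G ` A\<^sub>2 \<and> c \<in> A\<^sub>3 \<and> c \<notin> K) (fell_filter \<gamma>)"
    using g A1 A2 VK
    by (intro eventually_conj eventually_fell_filter_compact)
      (auto intro: eventually_fell_filter_open open_inv_image)
  then obtain c where c: "c \<in> A\<^sub>1" "c \<in> ginv G ` A\<^sub>2" "c \<in> A\<^sub>3" "c \<notin> K"
    using eventually_happens'[OF hausdorff_cover_nontrivial[OF \<gamma>]] by blast
  have "ginv G c \<in> A\<^sub>2"
    using c(2) inv_inv by auto
  \<comment> \<open>Here \<open>src G c\<close> arises as \<open>gmult G (ginv G c) c\<close>, and
    then \<open>c\<close> as \<open>gmult G c (src G c)\<close>.\<close>
  then have "src G c \<in> B"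
    using A2(5) c(3) by (metis inv_mult src_inv)
  then have "c \<in> V"
    using A1(5) c(1) by (metis mult_src rng_src)
  then show False
    using c(4) VK(4) by blast
qed

text \<open>All elements of \<open>\<gamma>\<close> share one source, so \<open>U\<close> contains
  at most one of them. If it contains \<open>h\<close>, continuity at \<open>h\<close> gives the
  limit \<open>f h\<close>; if none, the compact support is eventually avoided and the limit is
  0.\<close>

lemma Cc_on_tendsto_fell:
  assumes \<gamma>: "\<gamma> \<in> hausdorff_cover" and "finite \<gamma>" and U: "open_bisection G U" and f: "f \<in> Cc_on U"
  shows "(f \<longlongrightarrow> (\<Sum>h\<in>\<gamma>. f h)) (fell_filter \<gamma>)"
proof (cases "\<gamma> \<inter> U = {}")
  case True
  let ?K = "top_of_set U closure_of {g \<in> U. f g \<noteq> 0}"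
  have "compact ?K" "\<gamma> \<inter> ?K = {}"
    using f True closure_of_subset_topspace[of "top_of_set U"] unfolding Cc_on_def by auto
  then have "eventually (\<lambda>c. c \<notin> ?K) (fell_filter \<gamma>)"
    by (rule eventually_fell_filter_compact)
  moreover have "f c = 0" if "c \<notin> ?K" for c
    using that f closure_of_subset[of "{g \<in> U. f g \<noteq> 0}" "top_of_set U"]
    unfolding Cc_on_def by auto
  ultimately have "eventually (\<lambda>c. f c = 0) (fell_filter \<gamma>)"
    by (simp add: eventually_mono)
  moreover have "(\<Sum>h\<in>\<gamma>. f h) = 0"
    using True f by (intro sum.neutral) (auto simp: Cc_on_def)
  ultimately show ?thesis
    by (simp add: tendsto_eventually)
next
  case False
  then obtain h where h: "h \<in> \<gamma>" "h \<in> U" by blast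
  have "f k = 0" if "k \<in> \<gamma> - {h}" for k
    using that h f U hausdorff_cover_src[OF \<gamma>, of k h]
    by (auto simp: Cc_on_def open_bisection_def inj_on_def)
  then have "(\<Sum>h\<in>\<gamma>. f h) = f h"
    using sum.remove[OF \<open>finite \<gamma>\<close> h(1), of f] by simp
  moreover have "continuous_on U f" "open U"
    using f U by (simp_all add: Cc_on_def open_bisection_def)
  then have "(f \<longlongrightarrow> f h) (at h)"
    using h(2) at_within_open[of h U] by (metis continuous_on_def)
  then have "(f \<longlongrightarrow> f h) (nhds h)"
    by (simp add: tendsto_at_iff_tendsto_nhds)
  ultimately show ?thesis
    using tendsto_mono[OF fell_filter_le_nhds[OF h(1)]] by simp
qed

lemma Cc_tendsto_fell:
  assumes "\<gamma> \<in> hausdorff_cover" "finite \<gamma>" "f \<in> Cc G"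
  shows "(f \<longlongrightarrow> (\<Sum>h\<in>\<gamma>. f h)) (fell_filter \<gamma>)"
proof -
  obtain F a where F: "finite F" "F \<subseteq> (\<Union>U\<in>{U. open_bisection G U}. Cc_on U)"
    and f: "f = (\<lambda>g. \<Sum>\<phi>\<in>F. a \<phi> * \<phi> g)"
    using assms(3) unfolding Cc_def by blast
  have "(\<Sum>h\<in>\<gamma>. f h) = (\<Sum>\<phi>\<in>F. a \<phi> * (\<Sum>h\<in>\<gamma>. \<phi> h))"
    unfolding f sum_distrib_left by (rule sum.swap)
  moreover have "((\<lambda>g. \<Sum>\<phi>\<in>F. a \<phi> * \<phi> g) \<longlongrightarrow> (\<Sum>\<phi>\<in>F. a \<phi> * (\<Sum>h\<in>\<gamma>. \<phi> h))) (fell_filter \<gamma>)"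
    by (intro tendsto_sum tendsto_mult_left) (use F assms(1,2) in \<open>blast intro: Cc_on_tendsto_fell\<close>)
  ultimately show ?thesis
    unfolding f by simp
qed

text \<open>A compact set missing \<open>g\<close> is missed by a neighbourhood of \<open>g\<close>.
  This is what makes functions in \<open>Cc G\<close> continuous at \<open>g\<close>.\<close>

lemma nhds_le_fell_filter_nondangerous:
  assumes "src G g \<notin> dangerous_units G"
  shows "nhds g \<le> fell_filter {g}"
proof (rule le_fell_filterI)
  fix K assume "compact K" "{g} \<inter> K = {}"
  then obtain V where "open V" "g \<in> V" "V \<inter> K = {}"
    using compact_avoid_nondangerous[OF assms, of K] by blast
  then show "eventually (\<lambda>c. c \<notin> K) (nhds g)"
    unfolding eventually_nhds by blast
qed (auto simp: eventually_nhds)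

text \<open>Each element of \<open>\<gamma>\<close> is \<open>g\<close> times an element of
  \<open>cover_src G \<gamma>\<close>, and \<open>a = gmult G a (src G a)\<close>. So
  \<open>a\<close> approaches all of \<open>\<gamma>\<close> once \<open>a\<close> approaches
  \<open>g\<close> and \<open>src G a\<close> approaches
  \<open>cover_src G \<gamma>\<close>.\<close>

lemma nhds_inf_src_le_fell_filter:
  assumes \<gamma>: "\<gamma> \<in> hausdorff_cover" and g: "g \<in> \<gamma>"
  shows "inf (nhds g) (filtercomap (src G) (fell_filter (cover_src G \<gamma>))) \<le> fell_filter \<gamma>"
proof (rule le_fell_filterI)
  fix W h assume W: "open W" "h \<in> \<gamma>" "h \<in> W"
  let ?k = "gmult G (ginv G g) h"
  have rng: "rng G g = rng G h"
    by (rule hausdorff_cover_rng[OF \<gamma> g W(2)])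
  then have "src G g = rng G ?k" "gmult G g ?k \<in> W"
    using W(3) by (simp_all add: rng_mult src_inv rng_inv inv_mult_cancel)
  then obtain A B where AB: "open A" "g \<in> A" "open B" "?k \<in> B"
    "\<forall>a\<in>A. \<forall>b\<in>B. src G a = rng G b \<longrightarrow> gmult G a b \<in> W"
    by (rule mult_neighbourhoods[OF _ W(1)])
  have "?k \<in> cover_src G \<gamma>"
    using g W(2) unfolding cover_src_def by blast
  then have "eventually (\<lambda>x. x \<in> B) (fell_filter (cover_src G \<gamma>))"
    using AB(3,4) by (intro eventually_fell_filter_open)
  then have "eventually (\<lambda>a. src G a \<in> B) (filtercomap (src G) (fell_filter (cover_src G \<gamma>)))"
    by (rule eventually_filtercomapI)
  moreover have "eventually (\<lambda>a. a \<in> A) (nhds g)"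
    using AB(1,2) by (rule eventually_nhds_in_open)
  moreover have "a \<in> W" if "a \<in> A" "src G a \<in> B" for a
    using AB(5) that by (metis mult_src rng_src)
  ultimately show "eventually (\<lambda>c. c \<in> W)
      (inf (nhds g) (filtercomap (src G) (fell_filter (cover_src G \<gamma>))))"
    unfolding eventually_inf by blast
next
  fix K assume K: "compact K" "\<gamma> \<inter> K = {}"
  obtain U where U: "open U" "g \<in> U" "inj_on (src G) U"
    by (rule src_locally_inj)
  obtain V L where VL: "open V" "compact L" "g \<in> V" "V \<subseteq> L" "L \<subseteq> U"
    by (rule compact_neighbourhood[OF U(1,2)])
  \<comment> \<open>If \<open>a\<close> in \<open>L\<close> lies in \<open>K\<close>, then
    \<open>src G a\<close>, being \<open>gmult G (ginv G a) a\<close>, lies in \<open>?Q\<close>. It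
    thus suffices that the source of \<open>\<gamma>\<close> avoids this compact set.\<close>
  let ?Q = "{gmult G (ginv G l) k | l k. l \<in> L \<and> k \<in> K \<and> rng G l = rng G k}"
  have "cover_src G \<gamma> \<inter> ?Q = {}"
  proof (rule ccontr)
    assume "cover_src G \<gamma> \<inter> ?Q \<noteq> {}"
    then obtain g\<^sub>1 g\<^sub>2 l k where eq: "gmult G (ginv G g\<^sub>1) g\<^sub>2 = gmult G (ginv G l) k"
      and gs: "g\<^sub>1 \<in> \<gamma>" "g\<^sub>2 \<in> \<gamma>" and lk: "l \<in> L" "k \<in> K" "rng G l = rng G k"
      unfolding cover_src_def by blast
    have "src G g\<^sub>1 = rng G (gmult G (ginv G g\<^sub>1) g\<^sub>2)"
      using hausdorff_cover_rng[OF \<gamma> gs] by (simp add: rng_mult src_inv rng_inv)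
    also have "\<dots> = src G l"
      unfolding eq using lk(3) by (simp add: rng_mult src_inv rng_inv)
    finally have "src G l = src G g"
      using hausdorff_cover_src[OF \<gamma> g gs(1)] by simp
    \<comment> \<open>Injectivity of \<open>src G\<close> on \<open>L\<close> identifies
      \<open>l\<close>, and \<open>k\<close> becomes a ternary product of elements of
      \<open>\<gamma>\<close>.\<close>
    then have "l = g"
      using U(2,3) VL(5) lk(1) by (meson inj_onD subsetD)
    then have "gmult G g (gmult G (ginv G g\<^sub>1) g\<^sub>2) = k"
      unfolding eq using lk(3) by (simp add: inv_mult_cancel)
    then show False
      using hausdorff_cover_ternary[OF \<gamma> g gs] lk(2) K(2) by blast
  qed
  then have "eventually (\<lambda>x. x \<notin> ?Q) (fell_filter (cover_src G \<gamma>))"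
    by (intro eventually_fell_filter_compact compact_inv_mult VL(2) K(1))
  then have "eventually (\<lambda>a. src G a \<notin> ?Q) (filtercomap (src G) (fell_filter (cover_src G \<gamma>)))"
    by (rule eventually_filtercomapI)
  moreover have "eventually (\<lambda>a. a \<in> V) (nhds g)"
    using VL(1,3) by (rule eventually_nhds_in_open)
  moreover have "a \<notin> K" if "a \<in> V" "src G a \<notin> ?Q" for a
  proof
    assume "a \<in> K"
    with that(1) VL(4) have "gmult G (ginv G a) a \<in> ?Q" by blast
    with that(2) show False by (simp only: inv_mult)
  qed
  ultimately show "eventually (\<lambda>c. c \<notin> K)
      (inf (nhds g) (filtercomap (src G) (fell_filter (cover_src G \<gamma>))))"
    unfolding eventually_inf by blast
qed

text \<open>As \<open>src G\<close> is open, the sources of a neighbourhood of \<open>g\<close>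
  include all units in an open set around \<open>src G g\<close>, and the filter on \<open>C\<close>
  enters that set.\<close>

lemma nhds_inf_src_nontrivial:
  assumes "src G g \<in> \<xi>" "inf (fell_filter \<xi>) (principal C) \<noteq> bot" "C \<subseteq> units G"
  shows "inf (nhds g) (filtercomap (src G) (inf (fell_filter \<xi>) (principal C))) \<noteq> bot"
proof
  assume "inf (nhds g) (filtercomap (src G) (inf (fell_filter \<xi>) (principal C))) = bot"
  then have "eventually (\<lambda>_. False) (inf (nhds g) (filtercomap (src G) (inf (fell_filter \<xi>) (principal C))))"
    by simp
  then obtain P Q where P: "eventually P (nhds g)"
    and Q: "eventually Q (filtercomap (src G) (inf (fell_filter \<xi>) (principal C)))"
    and PQ: "\<And>a. P a \<Longrightarrow> Q a \<Longrightarrow> False"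
    unfolding eventually_inf by blast
  obtain A where A: "open A" "g \<in> A" "\<And>a. a \<in> A \<Longrightarrow> P a"
    using P unfolding eventually_nhds by blast
  obtain R where R: "eventually R (inf (fell_filter \<xi>) (principal C))" "\<And>a. R (src G a) \<Longrightarrow> Q a"
    using Q unfolding eventually_filtercomap by blast
  obtain S where S: "open S" "src G ` A = units G \<inter> S"
    using open_map_src[OF A(1)] by (metis openin_open)
  have "src G g \<in> S"
    using A(2) S(2) by blast
  with S(1) assms(1) have "eventually (\<lambda>x. x \<in> S) (fell_filter \<xi>)"
    by (rule eventually_fell_filter_open)
  then have "eventually (\<lambda>x. x \<in> C \<longrightarrow> x \<in> S) (fell_filter \<xi>)"
    by (rule eventually_mono) simp
  then have "eventually (\<lambda>x. R x \<and> x \<in> S \<and> x \<in> C) (inf (fell_filter \<xi>) (principal C))"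
    using R(1) by (auto simp: eventually_inf_principal elim: eventually_elim2)
  then obtain x where "R x" "x \<in> S" "x \<in> C"
    using eventually_happens'[OF assms(2)] by blast
  then have "x \<in> src G ` A"
    using S(2) assms(3) by auto
  then obtain a where "a \<in> A" "src G a = x"
    by blast
  with A(3) R(2) PQ \<open>R x\<close> show False by blast
qed

text \<open>Let \<open>x\<close> converge to \<open>cover_src G \<gamma>\<close> through the non-dangerous units.  The elements \<open>a\<close> near a
  given \<open>g \<in> \<gamma>\<close> with source \<open>x\<close> then converge to \<open>\<gamma>\<close>.\<close>

lemma uniform_limit_sum_eq_0:
  assumes \<gamma>: "\<gamma> \<in> ess_cover G" and fin: "finite \<gamma>"
    and approx: "\<And>e. e > 0 \<Longrightarrow> \<exists>\<phi>\<in>Cc G. \<forall>g. cmod (f g - \<phi> g) \<le> e"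
    and zero: "\<And>g. src G g \<notin> dangerous_units G \<Longrightarrow> f g = 0"
  shows "(\<Sum>h\<in>\<gamma>. f h) = 0"
proof -
  let ?C = "units G - dangerous_units G"
  have \<gamma>': "\<gamma> \<in> hausdorff_cover" "cover_src G \<gamma> \<in> ess_cover_units G"
    using \<gamma> by (simp_all add: ess_cover_def)
  obtain g where g: "g \<in> \<gamma>"
    using hausdorff_cover_nonempty[OF \<gamma>'(1)] by blast
  let ?X = "cover_src G \<gamma>"
  let ?F = "inf (nhds g) (filtercomap (src G) (inf (fell_filter ?X) (principal ?C)))"
  have "src G g \<in> ?X"
    using g inv_mult[of g] unfolding cover_src_def by (metis (mono_tags, lifting) mem_Collect_eq)
  then have nontriv: "?F \<noteq> bot"
    using nhds_inf_src_nontrivial fell_filter_closure_nontrivial[OF ess_cover_units_closure[OF \<gamma>'(2)]]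
    by blast
  have "?F \<le> inf (nhds g) (filtercomap (src G) (fell_filter ?X))"
    by (intro inf_mono order_refl filtercomap_mono inf_le1)
  then have le: "?F \<le> fell_filter \<gamma>"
    using nhds_inf_src_le_fell_filter[OF \<gamma>'(1) g] by (rule order_trans)
  have "?F \<le> filtercomap (src G) (principal ?C)"
    by (intro le_infI2 filtercomap_mono inf_le2)
  then have ev: "eventually (\<lambda>a. src G a \<in> ?C) ?F"
    by (simp add: filtercomap_principal le_principal)
  have bound: "cmod (\<Sum>h\<in>\<gamma>. f h) \<le> (1 + real (card \<gamma>)) * e" if e: "e > 0" for e
  proof -
    obtain \<phi> where \<phi>: "\<phi> \<in> Cc G" "\<And>g. cmod (f g - \<phi> g) \<le> e"
      using approx[OF e] by blast
    have "(\<phi> \<longlongrightarrow> (\<Sum>h\<in>\<gamma>. \<phi> h)) ?F"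
      using Cc_tendsto_fell[OF \<gamma>'(1) fin \<phi>(1)] le by (rule tendsto_mono[rotated])
    then have "((\<lambda>a. cmod (\<phi> a)) \<longlongrightarrow> cmod (\<Sum>h\<in>\<gamma>. \<phi> h)) ?F"
      by (rule tendsto_norm)
    \<comment> \<open>Along \<open>?F\<close> the sources are non-dangerous, so \<open>f\<close>
      vanishes and \<open>\<phi>\<close> is bounded by the approximation error.\<close>
    moreover have "cmod (\<phi> a) \<le> e" if "src G a \<in> ?C" for a
      using \<phi>(2)[of a] zero[of a] that by simp
    then have "eventually (\<lambda>a. cmod (\<phi> a) \<le> e) ?F"
      using ev by (rule eventually_mono[rotated])
    ultimately have 1: "cmod (\<Sum>h\<in>\<gamma>. \<phi> h) \<le> e"
      using nontriv by (rule tendsto_upperbound)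
    have "cmod (\<Sum>h\<in>\<gamma>. f h - \<phi> h) \<le> real (card \<gamma>) * e"
      by (rule sum_norm_bound) (rule \<phi>(2))
    then show ?thesis
      using 1 norm_triangle_ineq[of "\<Sum>h\<in>\<gamma>. f h - \<phi> h" "\<Sum>h\<in>\<gamma>. \<phi> h"]
      by (simp add: sum_subtractf algebra_simps)
  qed
  show ?thesis
  proof (rule ccontr)
    \<comment> \<open>With \<open>e\<close> equal to the norm divided by
      \<open>2 * (1 + real (card \<gamma>))\<close>, the bound makes the norm at most half of
      itself.\<close>
    assume "(\<Sum>h\<in>\<gamma>. f h) \<noteq> 0"
    then have "0 < cmod (\<Sum>h\<in>\<gamma>. f h) + real (card \<gamma>) * cmod (\<Sum>h\<in>\<gamma>. f h)"
      by (intro add_pos_nonneg) simp_all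
    with \<open>(\<Sum>h\<in>\<gamma>. f h) \<noteq> 0\<close> show False
      using bound[of "cmod (\<Sum>h\<in>\<gamma>. f h) / (2 * (1 + real (card \<gamma>)))"]
      by (simp add: field_simps)
  qed
qed

text \<open>Approximating functions are continuous at such \<open>g\<close>, so \<open>f\<close>
  stays nonzero on a whole neighbourhood, whose image under the open map \<open>src G\<close> is
  open in the units.\<close>

lemma uniform_limit_nonzero_interior:
  assumes approx: "\<And>e. e > 0 \<Longrightarrow> \<exists>\<phi>\<in>Cc G. \<forall>g. cmod (f g - \<phi> g) \<le> e"
    and g: "src G g \<notin> dangerous_units G" "f g \<noteq> 0"
  shows "src G g \<in> top_of_set (units G) interior_of (src G ` open_support f)"
proof -
  \<comment> \<open>A quarter leaves room for three errors: the approximation at \<open>g\<close>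
    and at \<open>a\<close>, and the variation of \<open>\<phi>\<close> between them.\<close>
  let ?e = "cmod (f g) / 4"
  obtain \<phi> where \<phi>: "\<phi> \<in> Cc G" "\<And>a. cmod (f a - \<phi> a) \<le> ?e"
    using approx[of ?e] g(2) by auto
  have "(\<phi> \<longlongrightarrow> \<phi> g) (fell_filter {g})"
    using Cc_tendsto_fell[of "{g}" \<phi>] iota_in_hausdorff_cover[of g] \<phi>(1) by (simp add: iota_def)
  then have "(\<phi> \<longlongrightarrow> \<phi> g) (nhds g)"
    using nhds_le_fell_filter_nondangerous[OF g(1)] by (rule tendsto_mono[rotated])
  then have "eventually (\<lambda>a. dist (\<phi> a) (\<phi> g) < ?e) (nhds g)"
    by (rule tendstoD) (use g(2) in simp)
  then obtain V where V: "open V" "g \<in> V" "\<And>a. a \<in> V \<Longrightarrow> dist (\<phi> a) (\<phi> g) < ?e"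
    unfolding eventually_nhds by blast
  have "f a \<noteq> 0" if "a \<in> V" for a
  proof
    assume "f a = 0"
    then have "cmod (\<phi> a) \<le> ?e"
      using \<phi>(2)[of a] by simp
    moreover have "cmod (f g) \<le> cmod (f g - \<phi> g) + cmod (\<phi> g - \<phi> a) + cmod (\<phi> a)"
      using norm_triangle_ineq[of "f g - \<phi> g" "\<phi> g"] norm_triangle_ineq[of "\<phi> g - \<phi> a" "\<phi> a"]
      by simp
    moreover have "cmod (\<phi> g - \<phi> a) < ?e"
      using V(3)[OF that] by (simp add: dist_norm norm_minus_commute)
    ultimately show False
      using \<phi>(2)[of g] norm_ge_zero[of "f g"] by linarith
  qed
  then have "src G ` V \<subseteq> src G ` open_support f"
    by (auto simp: open_support_def)
  then show ?thesis
    using interior_of_maximal[OF _ open_map_src[OF V(1)]] V(2) by blast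
qed

end

section \<open>The reduced algebra as functions\<close>

lemma finite_support_in_ell2:
  assumes "finite {g. \<xi> g \<noteq> 0}" "\<And>g. g \<notin> S \<Longrightarrow> \<xi> g = 0"
  shows "\<xi> \<in> ell2 S"
  using assms unfolding ell2_def by (auto intro: finite_nonzero_values_imp_summable_on)

lemma norm_le_ell2_norm:
  assumes "(\<lambda>g. (cmod (\<xi> g))\<^sup>2) summable_on UNIV"
  shows "cmod (\<xi> g) \<le> ell2_norm \<xi>"
proof -
  have "(\<Sum>h\<in>{g}. (cmod (\<xi> h))\<^sup>2) \<le> (\<Sum>\<^sub>\<infinity>h. (cmod (\<xi> h))\<^sup>2)"
    by (rule finite_sum_le_infsum[OF assms]) auto
  then show ?thesis
    unfolding ell2_norm_def by (simp add: real_le_rsqrt)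
qed

lemma ell2_summable: "\<xi> \<in> ell2 S \<Longrightarrow> (\<lambda>g. (cmod (\<xi> g))\<^sup>2) summable_on UNIV"
  by (simp add: ell2_def)

lemma delta_in_ell2: "g \<in> S \<Longrightarrow> delta g \<in> ell2 S"
  by (rule finite_support_in_ell2) (auto simp: delta_def)

lemma ell2_norm_delta: "ell2_norm (delta g) = 1"
proof -
  have "(\<Sum>\<^sub>\<infinity>h. (cmod (delta g h))\<^sup>2) = (\<Sum>\<^sub>\<infinity>h\<in>{g}. (cmod (delta g h))\<^sup>2)"
    by (rule infsum_cong_neutral) (auto simp: delta_def)
  then show ?thesis
    by (simp add: ell2_norm_def delta_def)
qed

lemma ell2_inner_delta: "ell2_inner \<xi> (delta g) = \<xi> g"
proof -
  have "(\<Sum>\<^sub>\<infinity>h. \<xi> h * cnj (delta g h)) = (\<Sum>\<^sub>\<infinity>h\<in>{g}. \<xi> h * cnj (delta g h))"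
    by (rule infsum_cong_neutral) (auto simp: delta_def)
  then show ?thesis
    by (simp add: ell2_inner_def delta_def)
qed

lemma summable_diff_finite_support:
  fixes \<xi> \<eta> :: "'g \<Rightarrow> complex"
  assumes "(\<lambda>g. (cmod (\<xi> g))\<^sup>2) summable_on UNIV" "finite {g. \<eta> g \<noteq> 0}"
  shows "(\<lambda>g. (cmod (\<xi> g - \<eta> g))\<^sup>2) summable_on UNIV"
proof -
  \<comment> \<open>The squared moduli differ only where \<open>\<eta>\<close> is nonzero.\<close>
  have "finite {g. (cmod (\<xi> g - \<eta> g))\<^sup>2 - (cmod (\<xi> g))\<^sup>2 \<noteq> 0}"
    by (rule finite_subset[OF _ assms(2)]) auto
  then have "(\<lambda>g. (cmod (\<xi> g - \<eta> g))\<^sup>2 - (cmod (\<xi> g))\<^sup>2) summable_on UNIV"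
    by (intro finite_nonzero_values_imp_summable_on) simp
  from summable_on_add[OF this assms(1)] show ?thesis
    by simp
qed

lemma ell2_finite_approximation:
  assumes \<xi>: "\<xi> \<in> ell2 S" and "e > 0"
  obtains F where "finite F" "F \<subseteq> S" "(\<lambda>g. if g \<in> F then 0 else \<xi> g) \<in> ell2 S"
    "ell2_norm (\<lambda>g. if g \<in> F then 0 else \<xi> g) \<le> e"
proof -
  let ?f = "\<lambda>g. (cmod (\<xi> g))\<^sup>2"
  have sum: "?f summable_on UNIV"
    by (rule ell2_summable[OF \<xi>])
  obtain F where F: "finite F" "dist (sum ?f F) (infsum ?f UNIV) \<le> e\<^sup>2"
    using has_sum_finite_approximation[OF has_sum_infsum[OF sum], of "e\<^sup>2"] \<open>e > 0\<close> by auto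
  \<comment> \<open>As \<open>\<xi>\<close> vanishes outside \<open>S\<close>, this restriction
    leaves the sum unchanged.\<close>
  let ?F = "F \<inter> S"
  let ?\<xi> = "\<lambda>g. if g \<in> ?F then 0 else \<xi> g"
  have "finite ?F" using F(1) by simp
  have sum_F: "sum ?f ?F = sum ?f F"
    using \<xi> by (intro sum.mono_neutral_left[OF F(1)]) (auto simp: ell2_def)
  have tail: "?f summable_on (UNIV - ?F)"
    by (rule summable_on_subset_banach[OF sum]) simp
  have "(\<lambda>g. (cmod (?\<xi> g))\<^sup>2) summable_on UNIV \<longleftrightarrow> ?f summable_on (UNIV - ?F)"
    by (rule summable_on_cong_neutral) auto
  with tail have in_ell2: "?\<xi> \<in> ell2 S"
    using \<xi> by (auto simp: ell2_def)
  have "(\<Sum>\<^sub>\<infinity>g. (cmod (?\<xi> g))\<^sup>2) = infsum ?f (UNIV - ?F)"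
    by (rule infsum_cong_neutral) auto
  also have "\<dots> = infsum ?f UNIV - sum ?f ?F"
    using infsum_Diff[OF sum, of ?F] \<open>finite ?F\<close> by simp
  also have "\<dots> \<le> e\<^sup>2"
    unfolding sum_F using F(2) by (simp add: dist_real_def)
  finally have "ell2_norm ?\<xi> \<le> e"
    unfolding ell2_norm_def using \<open>e > 0\<close> real_le_lsqrt by simp
  with \<open>finite ?F\<close> in_ell2 show ?thesis
    by (intro that[of ?F]) auto
qed

text \<open>Linearity kills finitely supported vectors; these approximate \<open>\<xi>\<close> in
  norm, and boundedness passes the estimate on to the values of \<open>T \<xi>\<close>.\<close>

lemma bounded_op_eq_0:
  assumes T: "T \<in> bounded_ops S" and zero: "\<And>h. h \<in> S \<Longrightarrow> T (delta h) = (\<lambda>_. 0)"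
    and \<xi>: "\<xi> \<in> ell2 S"
  shows "T \<xi> = (\<lambda>_. 0)"
proof
  fix g
  have lin: "T (\<lambda>g. a * \<xi> g + \<eta> g) = (\<lambda>g. a * T \<xi> g + T \<eta> g)"
    if "\<xi> \<in> ell2 S" "\<eta> \<in> ell2 S" for a \<xi> \<eta>
    using T that unfolding bounded_ops_def by simp
  obtain K where K: "\<And>\<xi>. \<xi> \<in> ell2 S \<Longrightarrow> ell2_norm (T \<xi>) \<le> K * ell2_norm \<xi>"
    using T unfolding bounded_ops_def by blast
  have "(\<lambda>_. 0) \<in> ell2 S"
    by (rule finite_support_in_ell2) auto
  then have T0: "T (\<lambda>_. 0) = (\<lambda>_. 0)"
    using lin[of "\<lambda>_. 0" "\<lambda>_. 0" 1] by (simp add: fun_eq_iff)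
  have fin: "T (\<lambda>g. if g \<in> F then \<xi> g else 0) = (\<lambda>_. 0)" if "finite F" "F \<subseteq> S" for F
    using that
  proof (induction F rule: finite_induct)
    case empty
    then show ?case by (simp add: T0)
  next
    case (insert h F)
    have "(\<lambda>g. if g \<in> insert h F then \<xi> g else 0)
        = (\<lambda>g. \<xi> h * delta h g + (if g \<in> F then \<xi> g else 0))"
      using insert.hyps by (auto simp: delta_def)
    moreover have "(\<lambda>g. if g \<in> F then \<xi> g else 0) \<in> ell2 S"
      using insert.prems insert.hyps(1) by (intro finite_support_in_ell2) (auto elim: finite_subset[rotated])
    ultimately show ?case
      using lin[of "delta h" "\<lambda>g. if g \<in> F then \<xi> g else 0" "\<xi> h"] delta_in_ell2[of h S]
        insert.prems insert.IH zero[of h] by simp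
  qed
  have "T \<xi> \<in> ell2 S"
    using T \<xi> unfolding bounded_ops_def by auto
  then have norm_le: "cmod (T \<xi> g) \<le> ell2_norm (T \<xi>)"
    by (intro norm_le_ell2_norm ell2_summable)
  have bound: "cmod (T \<xi> g) \<le> \<bar>K\<bar> * e" if "e > 0" for e
  proof -
    obtain F where F: "finite F" "F \<subseteq> S" "(\<lambda>g. if g \<in> F then 0 else \<xi> g) \<in> ell2 S"
      "ell2_norm (\<lambda>g. if g \<in> F then 0 else \<xi> g) \<le> e"
      using ell2_finite_approximation[OF \<xi> \<open>e > 0\<close>] by blast
    have "(\<lambda>g. if g \<in> F then \<xi> g else 0) \<in> ell2 S"
      using F(1,2) by (intro finite_support_in_ell2) (auto elim: finite_subset[rotated])
    from lin[OF this F(3), of 1] have "T \<xi> = T (\<lambda>g. if g \<in> F then 0 else \<xi> g)"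
      by (simp add: fin[OF F(1,2)] if_distrib cong: if_cong)
    then have "ell2_norm (T \<xi>) \<le> K * ell2_norm (\<lambda>g. if g \<in> F then 0 else \<xi> g)"
      using K[OF F(3)] by simp
    also have "\<dots> \<le> \<bar>K\<bar> * ell2_norm (\<lambda>g. if g \<in> F then 0 else \<xi> g)"
      by (intro mult_right_mono) (auto simp: ell2_norm_def intro: infsum_nonneg)
    also have "\<dots> \<le> \<bar>K\<bar> * e"
      using F(4) by (intro mult_left_mono) auto
    finally show ?thesis
      using norm_le by simp
  qed
  show "T \<xi> g = 0"
  proof (rule ccontr)
    assume "T \<xi> g \<noteq> 0"
    \<comment> \<open>Adding 1 to \<open>\<bar>K\<bar>\<close> avoids division by zero and makes the
      final inequality strict.\<close>
    then have pos: "cmod (T \<xi> g) / (\<bar>K\<bar> + 1) > 0"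
      by (intro divide_pos_pos) auto
    have "\<bar>K\<bar> * (cmod (T \<xi> g) / (\<bar>K\<bar> + 1)) < (\<bar>K\<bar> + 1) * (cmod (T \<xi> g) / (\<bar>K\<bar> + 1))"
      using pos by (intro mult_strict_right_mono) auto
    also have "\<dots> = cmod (T \<xi> g)"
      by simp
    finally show False
      using bound[OF pos] by simp
  qed
qed

section \<open>Matrix coefficients in the regular representations\<close>

lemma (in groupoid) convolution_delta:
  "convolution G f (delta h) g = (if src G g = src G h then f (gmult G g (ginv G h)) else 0)"
proof (cases "src G g = src G h")
  case True
  \<comment> \<open>Only pairs with second factor \<open>h\<close> contribute, and this forces the
    first factor.\<close>
  have "convolution G f (delta h) g
      = (\<Sum>\<^sub>\<infinity>p\<in>{(gmult G g (ginv G h), h)}. f (fst p) * delta h (snd p))"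
    unfolding convolution_def case_prod_unfold
  proof (rule infsum_cong_neutral)
    fix p assume "p \<in> {p. (fst p, snd p) \<in> composable G \<and> gmult G (fst p) (snd p) = g}
        - {(gmult G g (ginv G h), h)}"
    then show "f (fst p) * delta h (snd p) = 0"
      by (cases p) (auto simp: delta_def composable_def mult_cancel_inv)
  next
    fix p assume "p \<in> {(gmult G g (ginv G h), h)}
        - {p. (fst p, snd p) \<in> composable G \<and> gmult G (fst p) (snd p) = g}"
    then show "f (fst p) * delta h (snd p) = 0"
      using True by (auto simp: composable_def mult_inv_cancel src_mult rng_inv src_inv)
  qed auto
  then show ?thesis
    using True by (simp add: delta_def)
next
  case False
  have "convolution G f (delta h) g = 0"
    unfolding convolution_def
    by (rule infsum_0) (use False in \<open>auto simp: delta_def composable_def src_mult\<close>)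
  with False show ?thesis
    by simp
qed

text \<open>Each summand lives on a bisection, which meets a source fibre at most once.\<close>

lemma Cc_finite_on_fibre:
  assumes "f \<in> Cc G"
  shows "finite {g. src G g = x \<and> f g \<noteq> 0}"
proof -
  obtain F a where F: "finite F" "F \<subseteq> (\<Union>U\<in>{U. open_bisection G U}. Cc_on U)"
    and f: "f = (\<lambda>g. \<Sum>\<phi>\<in>F. a \<phi> * \<phi> g)"
    using assms unfolding Cc_def by blast
  have "finite {g. src G g = x \<and> \<phi> g \<noteq> 0}" if "\<phi> \<in> F" for \<phi>
  proof -
    obtain U where "open_bisection G U" "\<phi> \<in> Cc_on U"
      using F(2) \<open>\<phi> \<in> F\<close> by blast
    then have "inj_on (src G) U" "{g. src G g = x \<and> \<phi> g \<noteq> 0} \<subseteq> U"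
      by (auto simp: open_bisection_def Cc_on_def)
    then have "inj_on (src G) {g. src G g = x \<and> \<phi> g \<noteq> 0}"
      by (rule inj_on_subset)
    then show ?thesis
      by (rule inj_on_finite[of _ _ "{x}"]) auto
  qed
  then have "finite (\<Union>\<phi>\<in>F. {g. src G g = x \<and> \<phi> g \<noteq> 0})"
    using F(1) by blast
  moreover have "{g. src G g = x \<and> f g \<noteq> 0} \<subseteq> (\<Union>\<phi>\<in>F. {g. src G g = x \<and> \<phi> g \<noteq> 0})"
    unfolding f by (auto elim!: sum.not_neutral_contains_not_neutral)
  ultimately show ?thesis
    by (rule finite_subset[rotated])
qed

lemma op_family_dist_upper:
  assumes "x \<in> units G" "\<xi> \<in> ell2 (src_fibre G x)" "ell2_norm \<xi> \<le> 1"
  shows "ennreal (ell2_norm (\<lambda>g. T x \<xi> g - S x \<xi> g)) \<le> op_family_dist G T S"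
  unfolding op_family_dist_def
  by (rule SUP_upper2[OF assms(1)], rule SUP_upper) (use assms in simp)

text \<open>Coefficients are bounded by the operator norm, and by \<open>convolution_delta\<close>
  those of \<open>regular_rep G f\<close> are values of \<open>f\<close>. Closeness in norm thus
  controls all coefficients at once.\<close>

lemma (in topological_groupoid) reduced_algebra_approx:
  assumes T: "T \<in> reduced_algebra G" and "e > 0"
  obtains f where "f \<in> Cc G"
    "\<forall>g h. src G g = src G h \<longrightarrow> cmod (T (src G h) (delta h) g - f (gmult G g (ginv G h))) \<le> e"
proof -
  have "0 < ennreal e"
    using \<open>e > 0\<close> by simp
  with T have "\<exists>f\<in>Cc G. op_family_dist G T (regular_rep G f) < ennreal e"
    by (simp add: reduced_algebra_def)
  then obtain f where f: "f \<in> Cc G" "op_family_dist G T (regular_rep G f) < ennreal e"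
    by blast
  have "cmod (T (src G h) (delta h) g - f (gmult G g (ginv G h))) \<le> e" if gh: "src G g = src G h" for g h
  proof -
    let ?x = "src G h"
    let ?c = "convolution G f (delta h)"
    have x: "?x \<in> units G" by (rule src_in_units)
    have \<delta>: "delta h \<in> ell2 (src_fibre G ?x)"
      by (rule delta_in_ell2) (simp add: src_fibre_def)
    have c: "regular_rep G f ?x (delta h) = ?c"
      using x \<delta> by (simp add: regular_rep_def)
    \<comment> \<open>Finite support of \<open>?c\<close> makes the difference square-summable;
      otherwise the infinite sum in \<open>ell2_norm\<close> would take the default value 0 and
      bound nothing.\<close>
    have "{k. ?c k \<noteq> 0} \<subseteq> (\<lambda>k. gmult G k h) ` {k. src G k = rng G h \<and> f k \<noteq> 0}"
    proof
      fix k assume "k \<in> {k. ?c k \<noteq> 0}"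
      then have "src G k = src G h" "f (gmult G k (ginv G h)) \<noteq> 0"
        by (auto simp: convolution_delta split: if_splits)
      then show "k \<in> (\<lambda>k. gmult G k h) ` {k. src G k = rng G h \<and> f k \<noteq> 0}"
        by (intro rev_image_eqI[of "gmult G k (ginv G h)"])
          (simp_all add: src_mult rng_inv src_inv mult_inv_cancel)
    qed
    then have "finite {k. ?c k \<noteq> 0}"
      using Cc_finite_on_fibre[OF f(1)] by (meson finite_imageI finite_subset)
    moreover have "T ?x (delta h) \<in> ell2 (src_fibre G ?x)"
      using T x \<delta> unfolding reduced_algebra_def bounded_ops_def by blast
    ultimately have "cmod (T ?x (delta h) g - ?c g) \<le> ell2_norm (\<lambda>g. T ?x (delta h) g - ?c g)"
      by (intro norm_le_ell2_norm[of "\<lambda>g. T ?x (delta h) g - ?c g"] summable_diff_finite_support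
          ell2_summable)
    moreover have "ennreal (ell2_norm (\<lambda>g. T ?x (delta h) g - ?c g)) \<le> ennreal e"
      using op_family_dist_upper[OF x \<delta>, of T "regular_rep G f"] f(2)
      by (simp add: c ell2_norm_delta)
    ultimately have "cmod (T ?x (delta h) g - ?c g) \<le> e"
      using \<open>e > 0\<close> by (simp add: ennreal_le_iff)
    then show ?thesis
      using gh by (simp add: convolution_delta)
  qed
  with f(1) show ?thesis
    using that by blast
qed

lemma (in topological_groupoid) as_function_approx:
  assumes "T \<in> reduced_algebra G" "e > 0"
  shows "\<exists>f\<in>Cc G. \<forall>g. cmod (as_function G T g - f g) \<le> e"
proof -
  obtain f where f: "f \<in> Cc G"
    "\<forall>g h. src G g = src G h \<longrightarrow> cmod (T (src G h) (delta h) g - f (gmult G g (ginv G h))) \<le> e"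
    by (rule reduced_algebra_approx[OF assms])
  have "cmod (as_function G T g - f g) \<le> e" for g
    using f(2)[rule_format, of g "src G g"]
    by (simp add: as_function_def ell2_inner_delta src_src inv_unit[OF src_in_units] mult_src)
  with f(1) show ?thesis by blast
qed

text \<open>The coefficient of \<open>T\<close> at \<open>h\<close>, \<open>g\<close> and the value
  of its function at \<open>gmult G g (ginv G h)\<close> are both close to the same value of a
  function in \<open>Cc G\<close>. So all coefficients vanish, and they determine a bounded
  operator.\<close>

lemma (in topological_groupoid) as_function_eq_0_imp:
  assumes T: "T \<in> reduced_algebra G" and zero: "\<And>g. as_function G T g = 0"
  shows "T = reduced_zero G"
proof -
  have T': "T \<in> (\<Pi>\<^sub>E x\<in>units G. bounded_ops (src_fibre G x))"
    using T by (simp add: reduced_algebra_def)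
  have ge: "T (src G h) (delta h) g = 0" if "src G g = src G h" for g h
  proof (rule ccontr)
    let ?z = "T (src G h) (delta h) g"
    assume "?z \<noteq> 0"
    then have pos: "cmod ?z / 4 > 0" by simp
    from reduced_algebra_approx[OF T pos]
    obtain f where f:
      "\<forall>g h. src G g = src G h \<longrightarrow>
        cmod (T (src G h) (delta h) g - f (gmult G g (ginv G h))) \<le> cmod ?z / 4"
      by metis
    let ?k = "gmult G g (ginv G h)"
    have "cmod (f ?k) \<le> cmod ?z / 4"
      using zero[of ?k] f[rule_format, of ?k "src G ?k"]
      by (simp add: as_function_def ell2_inner_delta src_src inv_unit[OF src_in_units] mult_src)
    moreover have "cmod (?z - f ?k) \<le> cmod ?z / 4"
      using f that by blast
    moreover have "cmod ?z \<le> cmod (?z - f ?k) + cmod (f ?k)"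
      using norm_triangle_ineq[of "?z - f ?k" "f ?k"] by simp
    ultimately show False
      using pos by linarith
  qed
  have delta_0: "T x (delta h) = (\<lambda>_. 0)" if x: "x \<in> units G" and h: "h \<in> src_fibre G x" for x h
  proof
    fix g
    have "T x (delta h) \<in> ell2 (src_fibre G x)"
      using T' x delta_in_ell2[OF h] unfolding bounded_ops_def by blast
    then show "T x (delta h) g = 0"
      using ge[of g h] h unfolding ell2_def src_fibre_def by (cases "src G g = x") auto
  qed
  have "T x = reduced_zero G x" for x
  proof (cases "x \<in> units G")
    case True
    then have Tx: "T x \<in> bounded_ops (src_fibre G x)"
      using T' by blast
    have "T x \<xi> = reduced_zero G x \<xi>" for \<xi>
    proof (cases "\<xi> \<in> ell2 (src_fibre G x)")
      case xi: True
      then show ?thesis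
        using bounded_op_eq_0[OF Tx delta_0[OF True] xi] True by (simp add: reduced_zero_def)
    next
      case False
      \<comment> \<open>Off \<open>ell2 (src_fibre G x)\<close> both operators are
        \<open>undefined\<close> by extensionality.\<close>
      have "T x \<in> ell2 (src_fibre G x) \<rightarrow>\<^sub>E ell2 (src_fibre G x)"
        using Tx by (simp add: bounded_ops_def)
      then show ?thesis
        using False True PiE_arb by (fastforce simp: reduced_zero_def)
    qed
    then show ?thesis by blast
  next
    case False
    then show ?thesis
      using PiE_arb[OF T'] by (simp add: reduced_zero_def)
  qed
  then show ?thesis by blast
qed

section \<open>Membership of the zero family\<close>

lemma ell2_zero: "(\<lambda>_. 0) \<in> ell2 S"
  by (rule finite_support_in_ell2) auto

lemma ell2_lincomb:
  assumes "\<xi> \<in> ell2 S" "\<eta> \<in> ell2 S"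
  shows "(\<lambda>g. a * \<xi> g + \<eta> g) \<in> ell2 S"
proof -
  have "(\<lambda>g. (cmod (a * \<xi> g + \<eta> g))\<^sup>2) summable_on UNIV"
  proof (rule summable_on_comparison_test)
    show "(\<lambda>g. 2 * (cmod a)\<^sup>2 * (cmod (\<xi> g))\<^sup>2 + 2 * (cmod (\<eta> g))\<^sup>2) summable_on UNIV"
      by (intro summable_on_add summable_on_cmult_right ell2_summable[OF assms(1)]
          ell2_summable[OF assms(2)])
    fix g
    have "(cmod (a * \<xi> g + \<eta> g))\<^sup>2 \<le> (cmod a * cmod (\<xi> g) + cmod (\<eta> g))\<^sup>2"
      by (intro power_mono) (metis norm_mult norm_triangle_ineq, simp)
    also have "\<dots> \<le> 2 * (cmod a)\<^sup>2 * (cmod (\<xi> g))\<^sup>2 + 2 * (cmod (\<eta> g))\<^sup>2"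
      using zero_le_power2[of "cmod a * cmod (\<xi> g) - cmod (\<eta> g)"]
      by (simp add: power2_eq_square algebra_simps)
    finally show "(cmod (a * \<xi> g + \<eta> g))\<^sup>2
        \<le> 2 * (cmod a)\<^sup>2 * (cmod (\<xi> g))\<^sup>2 + 2 * (cmod (\<eta> g))\<^sup>2" .
  qed simp
  then show ?thesis
    using assms by (simp add: ell2_def)
qed

lemma (in topological_groupoid) reduced_zero_in_singular_ideal: "reduced_zero G \<in> singular_ideal G"
proof -
  have "(\<lambda>\<xi>\<in>ell2 S. (\<lambda>g. 0)) \<in> bounded_ops S" for S :: "'g set"
    unfolding bounded_ops_def
  proof (intro CollectI conjI exI[of _ 0])
    show "\<forall>a. \<forall>\<xi>\<in>ell2 S. \<forall>\<eta>\<in>ell2 S. (\<lambda>\<xi>\<in>ell2 S. (\<lambda>g. 0)) (\<lambda>g. a * \<xi> g + \<eta> g) =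
      (\<lambda>g. a * (\<lambda>\<xi>\<in>ell2 S. (\<lambda>g. 0)) \<xi> g + (\<lambda>\<xi>\<in>ell2 S. (\<lambda>g. 0)) \<eta> g)"
      by (simp add: ell2_lincomb)
  qed (auto simp: ell2_zero ell2_norm_def)
  then have "reduced_zero G \<in> (\<Pi>\<^sub>E x\<in>units G. bounded_ops (src_fibre G x))"
    unfolding reduced_zero_def by auto
  moreover have "(\<lambda>_. 0) \<in> Cc G"
    unfolding Cc_def by (intro CollectI exI[of _ "{}"]) auto
  moreover have "regular_rep G (\<lambda>_. 0) = reduced_zero G"
    by (simp add: regular_rep_def reduced_zero_def convolution_def[abs_def] case_prod_unfold)
  moreover have "op_family_dist G (reduced_zero G) (reduced_zero G) \<le> 0"
    unfolding op_family_dist_def by (intro SUP_least) (simp add: ell2_norm_def)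
  ultimately have "reduced_zero G \<in> reduced_algebra G"
    unfolding reduced_algebra_def by (intro CollectI conjI allI impI bexI[of _ "\<lambda>_. 0"]) simp_all
  moreover have "as_function G (reduced_zero G) g = 0" for g
    using src_in_units[of g] delta_in_ell2[of "src G g" "src_fibre G (src G g)"]
    by (simp add: as_function_def ell2_inner_delta reduced_zero_def src_fibre_def src_src)
  ultimately show ?thesis
    by (simp add: singular_ideal_def open_support_def)
qed

section \<open>Vanishing of the singular ideal\<close>

theorem corollary4p21:
  fixes G :: "'g::topological_space groupoid_ops"
  assumes "etale_groupoid G"
    and "\<not> Hausdorff_space (euclidean :: 'g topology)"
    and "\<exists>\<U>. countable \<U> \<and> (\<forall>U\<in>\<U>. open_bisection G U) \<and> \<Union>\<U> = UNIV"
    and "\<forall>\<gamma>\<in>(hausdorff_cover :: 'g set set). finite \<gamma>"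
    and "\<forall>f :: 'g set \<Rightarrow> complex. decomposable f \<longrightarrow>
      (\<forall>\<gamma>\<in>ess_cover G. f \<gamma> = 0) \<longrightarrow> (\<forall>\<gamma>\<in>hausdorff_cover. f \<gamma> = 0)"
  shows "singular_ideal G = {reduced_zero G}"
proof -
  interpret etale_groupoid G by fact
  have "T = reduced_zero G" if T: "T \<in> singular_ideal G" for T
  proof (rule as_function_eq_0_imp)
    show T_red: "T \<in> reduced_algebra G"
      using T by (simp add: singular_ideal_def)
    define f where "f = as_function G T"
    have approx: "\<exists>\<phi>\<in>Cc G. \<forall>g. cmod (f g - \<phi> g) \<le> e" if "e > 0" for e
      unfolding f_def by (rule as_function_approx[OF T_red that])
    have "top_of_set (units G) interior_of (src G ` open_support f) = {}"
      using T by (simp add: singular_ideal_def f_def)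
    \<comment> \<open>A nonzero value would put \<open>src G g\<close> into this empty
      interior.\<close>
    then have zero: "f g = 0" if "src G g \<notin> dangerous_units G" for g
      using uniform_limit_nonzero_interior[OF approx that] by blast
    \<comment> \<open>The function \<open>f\<close> is extended from singletons to the cover; as
      each \<open>\<gamma>\<close> is finite, discarding zero terms gives the decomposable
      form.\<close>
    define F where "F \<gamma> = (\<Sum>h\<in>\<gamma>. f h)" for \<gamma>
    have F_iota: "F (iota g) = f g" for g
      by (simp add: F_def iota_def)
    have "decomposable F"
      unfolding decomposable_def F_iota
    proof (intro ballI conjI)
      fix \<gamma> :: "'g set"
      assume "\<gamma> \<in> hausdorff_cover"
      then have "finite \<gamma>"
        using assms(4) by blast
      then show "finite {g \<in> \<gamma>. f g \<noteq> 0}"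
        by simp
      show "F \<gamma> = (\<Sum>g | g \<in> \<gamma> \<and> f g \<noteq> 0. f g)"
        unfolding F_def by (rule sum.mono_neutral_right[OF \<open>finite \<gamma>\<close>]) auto
    qed
    moreover have "F \<gamma> = 0" if "\<gamma> \<in> ess_cover G" for \<gamma>
      unfolding F_def
    proof (rule uniform_limit_sum_eq_0[OF that _ approx zero])
      show "finite \<gamma>"
        using assms(4) that by (simp add: ess_cover_def)
    qed
    ultimately have "F (iota g) = 0" for g
      using assms(5) iota_in_hausdorff_cover[of g] by blast
    then show "as_function G T g = 0" for g
      by (simp add: F_iota f_def)
  qed
  then show ?thesis
    using reduced_zero_in_singular_ideal by blast
qed

end
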